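(* Let $K\ge 3$ be an integer and let $S^\infty$ be the doubly infinite stack of homogeneous trees of degree $K$. There exists $\theta_*<1$ (depending on $K$) such that for every $\theta>\theta_*$ (with $\theta \le 1$) the majority-dynamics process on $S^\infty$, started from the i.i.d. initial configuration with density $\theta$ of $+1$ spins, fixates to consensus, i.e. for every vertex $x$ of $S^\infty$, $$\mathbb{P}_\theta\big(\text{there exists } T=T(\sigma(0),\omega,x)<\infty \text{ such that } \sigma_x(t)=+1 \text{ for all } t\ge T\big)=1 .$$
   Context: $\mathbb{T}_K$ denotes the homogeneous (infinite, regular) tree in which every vertex has degree $K$. The graph $S^\infty$ has vertex set $\mathbb{T}_K\times\mathbb{Z}$; two vertices $(u,j)$ and $(v,k)$ are joined by an edge if and only if either $j=k$ and $u,v$ are adjacent in $\mathbb{T}_K$, or $u=v$ and $|j-k|=1$. The process on a graph $G$: $\sigma_x(t)\in\{+1,-1\}$ is the spin at vertex $x$ at time $t\ge 0$. The initial spins $\{\sigma_x(0)\}_{x\in G}$ are drawn from the independent Bernoulli product measure $\mu_\theta$ with $\mu_\theta(\sigma_x(0)=+1)=\theta=1-\mu_\theta(\sigma_x(0)=-1)$. To each vertex $x$ is attached a rate $1$ Poisson process of clock rings $\{\tau_{x,n}\}_{n\ge1}$, independent for different vertices, and to each $(x,n)$ an independent fair coin with values $+1$ or $-1$ (independent of the clocks). At each clock ring of $x$, the spin at $x$ is updated to agree with the (strict) majority of the current spins of its neighbors; if there is a tie among the neighbors, the spin at $x$ takes the value of the corresponding coin toss. Spins do not change otherwise. $\mathbb{P}_{\mathrm{dyn}}$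 is the law of the clock rings and coin tosses, and $\mathbb{P}_\theta=\mu_\theta\times\mathbb{P}_{\mathrm{dyn}}$ is the joint law of the initial configuration and the dynamics; $\omega$ denotes an element of the underlying probability space. *)

theory Defs
  imports "HOL-Probability.Probability"
begin

text \<open>
  Graphs are simple and undirected. The vertex set is a whole type and adjacency is a
  symmetric irreflexive relation on it. (A symmetric digraph in the sense of the AFP entry
  Graph-Theory with at least one edge always has directed 2-cycles, so the predicate \<open>tree\<close>
  of that entry does not describe undirected trees.)
\<close>

definition simple_graph :: "('v \<Rightarrow> 'v \<Rightarrow> bool) \<Rightarrow> bool" where
  "simple_graph adj \<longleftrightarrow> symp adj \<and> irreflp adj"

definition connected_graph :: "('v \<Rightarrow> 'v \<Rightarrow> bool) \<Rightarrow> bool" where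
  "connected_graph adj \<longleftrightarrow> (\<forall>u v. adj\<^sup>*\<^sup>* u v)"

definition graph_cycle :: "('v \<Rightarrow> 'v \<Rightarrow> bool) \<Rightarrow> 'v list \<Rightarrow> bool" where
  "graph_cycle adj p \<longleftrightarrow>
     length p \<ge> 3 \<and> distinct p \<and> successively adj p \<and> adj (last p) (hd p)"

definition tree_graph :: "('v \<Rightarrow> 'v \<Rightarrow> bool) \<Rightarrow> bool" where
  "tree_graph adj \<longleftrightarrow> simple_graph adj \<and> connected_graph adj \<and> (\<nexists>p. graph_cycle adj p)"

definition homogeneous_tree :: "nat \<Rightarrow> ('v \<Rightarrow> 'v \<Rightarrow> bool) \<Rightarrow> bool" where
  "homogeneous_tree K adj \<longleftrightarrow>
     tree_graph adj \<and> infinite (UNIV :: 'v set) \<and>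
     (\<forall>u. finite {v. adj u v} \<and> card {v. adj u v} = K)"

definition stack :: "('v \<Rightarrow> 'v \<Rightarrow> bool) \<Rightarrow> 'v \<times> int \<Rightarrow> 'v \<times> int \<Rightarrow> bool" where
  "stack adj x y \<longleftrightarrow>
     (snd x = snd y \<and> adj (fst x) (fst y)) \<or> (fst x = fst y \<and> \<bar>snd x - snd y\<bar> = 1)"

datatype spin = Plus | Minus

definition majority_update ::
    "('x \<Rightarrow> 'x \<Rightarrow> bool) \<Rightarrow> ('x \<Rightarrow> spin) \<Rightarrow> spin \<Rightarrow> 'x \<Rightarrow> spin" where
  "majority_update adj \<eta> coin x =
     (let p = card {y. adj x y \<and> \<eta> y = Plus};
          m = card {y. adj x y \<and> \<eta> y = Minus}
      in if p > m then Plus else if p < m then Minus else coin)"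

text \<open>
  Trajectories of the dynamics driven by an initial configuration, by clock rings (\<open>ring x n\<close> is
  the time of the \<open>n\<close>-th ring of \<open>x\<close>, counted from 0) and by tie-breaking coins.
  At a ring, the current spins are the left limits of the spins at that time.
  Negative times carry no meaning; the initial configuration is used there only to make
  trajectories unique as functions on the whole real line.
\<close>

definition majority_trajectory ::
    "('x \<Rightarrow> 'x \<Rightarrow> bool) \<Rightarrow> ('x \<Rightarrow> spin) \<Rightarrow> ('x \<Rightarrow> nat \<Rightarrow> real) \<Rightarrow> ('x \<Rightarrow> nat \<Rightarrow> spin)
      \<Rightarrow> ('x \<Rightarrow> real \<Rightarrow> spin) \<Rightarrow> bool" where
  "majority_trajectory adj init ring coin \<sigma> \<longleftrightarrow>
     (\<forall>x. \<forall>t\<le>0. \<sigma> x t = init x) \<and>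
     (\<forall>x s t. 0 \<le> s \<and> s < t \<and> (\<forall>n. ring x n \<notin> {s<..t}) \<longrightarrow> \<sigma> x t = \<sigma> x s) \<and>
     (\<forall>x n. \<forall>\<^sub>F s in at_left (ring x n).
        \<sigma> x (ring x n) = majority_update adj (\<lambda>y. \<sigma> y s) (coin x n) x)"

definition spin_law :: "real \<Rightarrow> spin pmf" where
  "spin_law \<theta> = map_pmf (\<lambda>b. if b then Plus else Minus) (bernoulli_pmf \<theta>)"

definition initial_law :: "real \<Rightarrow> ('x \<Rightarrow> spin) measure" where
  "initial_law \<theta> = (\<Pi>\<^sub>M x\<in>UNIV. measure_pmf (spin_law \<theta>))"

text \<open>
  The rate 1 Poisson processes are encoded by their i.i.d. exponential waiting times:
  coordinate \<open>(x, n)\<close> is the time between consecutive rings of \<open>x\<close>, and \<open>ring_time\<close> recovers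
  the rings.
\<close>

definition waiting_law :: "('x \<times> nat \<Rightarrow> real) measure" where
  "waiting_law = (\<Pi>\<^sub>M i\<in>UNIV. density lborel (exponential_density 1))"

definition ring_time :: "('x \<times> nat \<Rightarrow> real) \<Rightarrow> 'x \<Rightarrow> nat \<Rightarrow> real" where
  "ring_time w x n = (\<Sum>i\<le>n. w (x, i))"

definition coin_law :: "('x \<times> nat \<Rightarrow> spin) measure" where
  "coin_law = (\<Pi>\<^sub>M i\<in>UNIV. measure_pmf (spin_law (1/2)))"

definition dyn_law :: "(('x \<times> nat \<Rightarrow> real) \<times> ('x \<times> nat \<Rightarrow> spin)) measure" where
  "dyn_law = waiting_law \<Otimes>\<^sub>M coin_law"

type_synonym 'x sample = "('x \<Rightarrow> spin) \<times> ('x \<times> nat \<Rightarrow> real) \<times> ('x \<times> nat \<Rightarrow> spin)"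

definition joint_law :: "real \<Rightarrow> 'x sample measure" where
  "joint_law \<theta> = initial_law \<theta> \<Otimes>\<^sub>M dyn_law"

text \<open>
  On a graph of bounded degree the trajectory exists and is unique for almost every sample
  point (Harris' graphical construction); on the exceptional null set the value of \<open>THE\<close> is
  irrelevant.
\<close>

definition majority_process :: "('x \<Rightarrow> 'x \<Rightarrow> bool) \<Rightarrow> 'x sample \<Rightarrow> 'x \<Rightarrow> real \<Rightarrow> spin" where
  "majority_process adj = (\<lambda>(init, w, c).
     THE \<sigma>. majority_trajectory adj init (ring_time w) (\<lambda>x n. c (x, n)) \<sigma>)"

definition fixates_to_plus :: "('x \<Rightarrow> 'x \<Rightarrow> bool) \<Rightarrow> real \<Rightarrow> bool" where
  "fixates_to_plus adj \<theta> \<longleftrightarrow>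
     (\<forall>x. AE \<omega> in joint_law \<theta>. \<exists>T. \<forall>t\<ge>T. majority_process adj \<omega> x t = Plus)"

lemma prob_space_joint_law: "prob_space (joint_law \<theta>)"
proof -
  have "prob_space (initial_law \<theta>)" for \<theta>
    unfolding initial_law_def by (intro prob_space_PiM prob_space_measure_pmf)
  moreover have "prob_space waiting_law"
    unfolding waiting_law_def by (intro prob_space_PiM prob_space_exponential_density) simp
  moreover have "prob_space coin_law"
    unfolding coin_law_def by (intro prob_space_PiM prob_space_measure_pmf)
  ultimately show ?thesis
    unfolding joint_law_def dyn_law_def by (intro prob_space_pair)
qed

end

theory Submission
  imports Defs
begin

text \<open>
  Call a vertex fixated if it is eventually \<open>Plus\<close> forever. A vertex most of whose neighbours are
  fixated is itself fixated, because its clock rings again. Pair the layers \<open>2 * j\<close> and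
  \<open>2 * j + 1\<close>, and in each pair run bootstrap percolation with threshold two on the tree,
  started from the blocks that contain a \<open>Minus\<close>. A vertex of an uninfected block has at least
  \<open>K\<close> of its \<open>K + 2\<close> neighbours in uninfected blocks, so the uninfected blocks are \<open>Plus\<close> at all
  times. A tree is a forest, so a finite set that is infected from within contains at least half
  as many initially infected vertices as vertices; counting connected sets, a small density of
  \<open>Minus\<close> excludes infinite clusters of infected blocks. A finite cluster of vertices that do not
  fixate cannot exist, since a leaf of its top level has most of its neighbours outside.

  The trajectory is unique by Harris' construction. Within a time slice of small length the
  vertices that ring form finite clusters, by the same counting, and this makes the influence
  relation on rings well-founded.
\<close>

section \<open>Connected finite sets\<close>

text \<open>These are the lattice animals rooted at \<open>u\<close>: finite connected sets, grown
  vertex by vertex so that induction can follow the growth.\<close>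

inductive animal :: "('v \<Rightarrow> 'v \<Rightarrow> bool) \<Rightarrow> 'v \<Rightarrow> 'v set \<Rightarrow> bool" for adj u where
  base: "animal adj u {u}"
| step: "animal adj u C \<Longrightarrow> x \<in> C \<Longrightarrow> adj x y \<Longrightarrow> y \<notin> C \<Longrightarrow> animal adj u (insert y C)"

lemma animal_finite: "animal adj u C \<Longrightarrow> finite C"
  by (induction rule: animal.induct) auto

lemma animal_root: "animal adj u C \<Longrightarrow> u \<in> C"
  by (induction rule: animal.induct) auto

text \<open>Attaching \<open>y\<close> to \<open>x\<close> amounts to inserting the detour from
  \<open>x\<close> to \<open>y\<close> and back into the walk, which costs two vertices.\<close>

lemma animal_walk:
  assumes "symp adj" "animal adj u C"
  shows "\<exists>w. length w = 2 * card C - 1 \<and> w \<noteq> [] \<and> hd w = u \<and> successively adj w \<and> set w = C"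
  using assms(2)
proof (induction rule: animal.induct)
  case base
  then show ?case by (intro exI[of _ "[u]"]) auto
next
  case (step C x y)
  then obtain w where w: "length w = 2 * card C - 1" "w \<noteq> []" "hd w = u"
    "successively adj w" "set w = C" by blast
  from step.hyps w obtain a b where ab: "w = a @ x # b"
    by (metis split_list)
  have fin: "finite C" using step.hyps(1) by (rule animal_finite)
  let ?w = "a @ x # y # x # b"
  have "adj y x" using step.hyps assms(1) by (auto dest: sympD)
  then have "successively adj ?w" using w(4) step.hyps unfolding ab
    by (auto simp: successively_append_iff successively_Cons)
  moreover have "hd ?w = u" using w(3) unfolding ab by (cases a) auto
  moreover have "set ?w = insert y C" using w(5) unfolding ab by auto
  moreover have "card C > 0" using fin step.hyps by (auto simp: card_gt_0_iff)
  then have "length ?w = 2 * card (insert y C) - 1"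
    using w(1) step.hyps fin unfolding ab by simp
  ultimately show ?case by blast
qed

section \<open>Counting walks and connected sets\<close>

lemma card_walks:
  assumes "\<And>u. finite {v. adj u v}" "\<And>u. card {v. adj u v} \<le> D"
  shows "finite {w. length w = Suc n \<and> hd w = u \<and> successively adj w} \<and>
    card {w. length w = Suc n \<and> hd w = u \<and> successively adj w} \<le> D ^ n"
proof (induction n arbitrary: u)
  case 0
  have "{w. length w = Suc 0 \<and> hd w = u \<and> successively adj w} = {[u]}"
    by (auto simp: length_Suc_conv)
  then show ?case by simp
next
  case (Suc n)
  let ?W = "\<lambda>n u. {w. length w = Suc n \<and> hd w = u \<and> successively adj w}"
  have sub: "?W (Suc n) u = (\<Union>v\<in>{v. adj u v}. (#) u ` ?W n v)"
    by (auto simp: length_Suc_conv successively_Cons image_iff)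
  have "card (?W (Suc n) u) \<le> (\<Sum>v\<in>{v. adj u v}. card ((#) u ` ?W n v))"
    unfolding sub by (intro card_UN_le assms)
  also have "\<dots> \<le> (\<Sum>v\<in>{v. adj u v}. D ^ n)"
    using Suc by (intro sum_mono order_trans[OF card_image_le]) auto
  also have "\<dots> \<le> D ^ Suc n" using assms(2)[of u] by simp
  finally show ?case using Suc assms(1) unfolding sub by auto
qed

text \<open>A set with \<open>m\<close> vertices is the range of a walk from \<open>u\<close> with
  \<open>2 * m - 1\<close> vertices, that is, with \<open>2 * m - 2\<close> steps of at most
  \<open>D\<close> choices each.\<close>

lemma card_animals:
  assumes "symp adj" "\<And>u. finite {v. adj u v}" "\<And>u. card {v. adj u v} \<le> D" "m \<ge> 1"
  shows "finite {C. animal adj u C \<and> card C = m}"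
    "card {C. animal adj u C \<and> card C = m} \<le> D ^ (2 * m - 2)"
proof -
  let ?W = "{w. length w = Suc (2 * m - 2) \<and> hd w = u \<and> successively adj w}"
  have fin: "finite ?W" and le: "card ?W \<le> D ^ (2 * m - 2)"
    using card_walks[of adj D "2 * m - 2" u, OF assms(2,3)] by blast+
  have sub: "{C. animal adj u C \<and> card C = m} \<subseteq> set ` ?W"
  proof safe
    fix C assume C: "animal adj u C" "m = card C"
    from animal_walk[OF assms(1) C(1)] obtain w where
      "length w = 2 * card C - 1" "hd w = u" "successively adj w" "set w = C" by blast
    then show "C \<in> set ` {w. length w = Suc (2 * card C - 2) \<and> hd w = u \<and> successively adj w}"
      using assms(4) C by (intro image_eqI[of _ _ w]) auto
  qed
  show "finite {C. animal adj u C \<and> card C = m}"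
    using finite_subset[OF sub] fin by blast
  show "card {C. animal adj u C \<and> card C = m} \<le> D ^ (2 * m - 2)"
    using card_mono[OF _ sub] card_image_le[OF fin, of set] fin le by fastforce
qed

section \<open>Clusters\<close>

text \<open>Only the vertices after the start of the path must lie in \<open>Y\<close>, so the
  cluster contains \<open>u\<close> even if \<open>Y\<close> does not.\<close>

definition reach :: "('v \<Rightarrow> 'v \<Rightarrow> bool) \<Rightarrow> 'v set \<Rightarrow> 'v \<Rightarrow> 'v set" where
  "reach adj Y u = {y. (\<lambda>a b. adj a b \<and> b \<in> Y)\<^sup>*\<^sup>* u y}"

lemma reach_root: "u \<in> reach adj Y u"
  by (simp add: reach_def)

lemma reach_step: "x \<in> reach adj Y u \<Longrightarrow> adj x y \<Longrightarrow> y \<in> Y \<Longrightarrow> y \<in> reach adj Y u"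
  by (auto simp: reach_def intro: rtranclp.rtrancl_into_rtrancl)

lemma reach_sub: "u \<in> Y \<Longrightarrow> reach adj Y u \<subseteq> Y"
  by (auto simp: reach_def elim: rtranclp.cases)

lemma animal_reach: "animal adj u C \<Longrightarrow> C \<subseteq> Y \<Longrightarrow> C \<subseteq> reach adj Y u"
  by (induction rule: animal.induct) (auto simp: reach_root intro: reach_step)

lemma reach_boundary:
  assumes "u \<in> A" "A \<subset> reach adj Y u"
  shows "\<exists>x\<in>A. \<exists>y\<in>reach adj Y u - A. adj x y"
proof -
  obtain z where z: "z \<in> reach adj Y u" "z \<notin> A" using assms by auto
  have "(\<lambda>a b. adj a b \<and> b \<in> Y)\<^sup>*\<^sup>* u z" using z by (simp add: reach_def)
  then have "z \<notin> A \<Longrightarrow> ?thesis"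
  proof (induction rule: rtranclp_induct)
    case base
    then show ?case using assms by simp
  next
    case (step y z)
    have "y \<in> reach adj Y u" "z \<in> reach adj Y u"
      using step.hyps by (auto simp: reach_def intro: rtranclp.rtrancl_into_rtrancl)
    then show ?case using step by blast
  qed
  then show ?thesis using z by blast
qed

text \<open>An animal inside the cluster is enlarged by boundary vertices until it has the desired
  size. So ruling out large animals rules out infinite clusters.\<close>

lemma animal_in_reach:
  assumes "n \<ge> 1" "infinite (reach adj Y u) \<or> n \<le> card (reach adj Y u)"
  shows "\<exists>A. animal adj u A \<and> A \<subseteq> reach adj Y u \<and> card A = n"
  using assms
proof (induction n rule: nat_induct_at_least)
  case base
  then show ?case by (intro exI[of _ "{u}"]) (auto intro: animal.base simp: reach_root)
next
  case (Suc n)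
  then have "infinite (reach adj Y u) \<or> n \<le> card (reach adj Y u)" by linarith
  then obtain A where A: "animal adj u A" "A \<subseteq> reach adj Y u" "card A = n"
    using Suc.IH by blast
  have "finite A" using A(1) by (rule animal_finite)
  then have "A \<subset> reach adj Y u" using A Suc.prems by auto
  from reach_boundary[OF animal_root[OF A(1)] this] obtain x y where
    xy: "x \<in> A" "y \<in> reach adj Y u" "y \<notin> A" "adj x y" by auto
  then have "animal adj u (insert y A)" using A by (intro animal.step)
  then show ?case using A xy \<open>finite A\<close> by (intro exI[of _ "insert y A"]) auto
qed

lemma finite_reach_animal:
  assumes "finite (reach adj Y u)"
  shows "animal adj u (reach adj Y u)"
proof -
  have "card (reach adj Y u) \<ge> 1"
    using assms reach_root[of u adj Y] by (auto simp: Suc_le_eq card_gt_0_iff)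
  then obtain A where "animal adj u A" "A \<subseteq> reach adj Y u" "card A = card (reach adj Y u)"
    using animal_in_reach[of "card (reach adj Y u)" adj Y u] by auto
  then show ?thesis using card_subset_eq[OF assms] by metis
qed

text \<open>The endpoints of walks of length \<open>n\<close> from one vertex form a finite set
  \<open>B n\<close>, and these sets exhaust the graph. Countability lets almost sure statements
  hold at all vertices at once.\<close>

lemma countable_connected:
  fixes adj :: "'v \<Rightarrow> 'v \<Rightarrow> bool"
  assumes "connected_graph adj" "\<And>u. finite {v. adj u v}"
  shows "countable (UNIV :: 'v set)"
proof -
  fix u :: 'v
  define B where "B = rec_nat {u} (\<lambda>_ S. \<Union>x\<in>S. {v. adj x v})"
  have fin: "finite (B n)" for n
    by (induction n) (auto simp: B_def assms(2))
  have "\<exists>n. v \<in> B n" for v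
  proof -
    have "adj\<^sup>*\<^sup>* u v" using assms(1) by (simp add: connected_graph_def)
    then show ?thesis
    proof (induction rule: rtranclp_induct)
      case base
      then show ?case by (intro exI[of _ 0]) (simp add: B_def)
    next
      case (step y z)
      then obtain n where "y \<in> B n" by auto
      then show ?case using step by (intro exI[of _ "Suc n"]) (auto simp: B_def)
    qed
  qed
  then have "UNIV = (\<Union>n. B n)" by auto
  then show ?thesis using fin by (metis countable_UN countable_finite countableI_type)
qed

section \<open>Finite subsets of forests\<close>

text \<open>The first vertex of a longest path in \<open>C\<close> has all its neighbours in
  \<open>C\<close> on that path; a neighbour other than the next vertex would close a cycle.\<close>

lemma forest_leaf:
  assumes "symp adj" "irreflp adj" "\<nexists>p. graph_cycle adj p" "finite C" "C \<noteq> {}"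
  shows "\<exists>x\<in>C. card {y\<in>C. adj x y} \<le> 1"
proof (rule ccontr)
  assume "\<not> ?thesis"
  then have deg: "card {y\<in>C. adj x y} \<ge> 2" if "x \<in> C" for x using that by force
  define P where "P p \<longleftrightarrow> p \<noteq> [] \<and> distinct p \<and> successively adj p \<and> set p \<subseteq> C" for p
  obtain c where "c \<in> C" using assms by auto
  then have "P [c]" by (simp add: P_def)
  moreover have "length p \<le> card C" if "P p" for p
    using that assms(4) by (metis P_def card_mono distinct_card)
  ultimately obtain p where p: "P p" "\<And>q. P q \<Longrightarrow> length q \<le> length p"
    using ex_has_greatest_nat[of P "[c]" length "Suc (card C)"] by (auto simp: less_Suc_eq_le)
  obtain x r where r: "p = x # r" using p(1) by (cases p) (auto simp: P_def)
  have xC: "x \<in> C" using p(1) r by (simp add: P_def)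
  have nb: "y \<in> set r" if "y \<in> C" "adj x y" for y
  proof (rule ccontr)
    assume y: "y \<notin> set r"
    have "y \<noteq> x" using that assms(2) by (auto dest: irreflpD)
    moreover have "adj y x" using that assms(1) by (auto dest: sympD)
    ultimately have "P (y # p)" using p(1) that y unfolding P_def r
      by (auto simp: successively_Cons)
    then show False using p(2)[of "y # p"] by simp
  qed
  have "\<not> {y\<in>C. adj x y} \<subseteq> {hd r}"
    using deg[OF xC] card_mono[of "{hd r}" "{y\<in>C. adj x y}"] by force
  then obtain y where y: "y \<in> C" "adj x y" "y \<noteq> hd r" by auto
  then obtain i where i: "i < length r" "r ! i = y" using nb by (metis in_set_conv_nth)
  \<comment> \<open>Position 0 is the next vertex of the path; excluding it gives the cycle below at
    least three vertices.\<close>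
  have "i \<noteq> 0" using i y by (metis hd_conv_nth length_0_conv less_nat_zero_code)
  let ?q = "x # take (Suc i) r"
  have lst: "last ?q = y" using i by (simp add: take_Suc_conv_app_nth)
  have eq: "p = ?q @ drop (Suc i) r" using r by simp
  have "successively adj ?q" using p(1) eq unfolding P_def
    by (metis successively_append_iff)
  moreover have "distinct ?q" using p(1) eq unfolding P_def by (metis distinct_append)
  moreover have "length ?q \<ge> 3" using i \<open>i \<noteq> 0\<close> by auto
  moreover have "adj (last ?q) (hd ?q)" unfolding lst using y assms(1) by (auto dest: sympD)
  ultimately have "graph_cycle adj ?q" unfolding graph_cycle_def by blast
  then show False using assms(3) by blast
qed

section \<open>Edges of forests\<close>

text \<open>Ordered pairs count each undirected edge twice, whence the factors 2 and 4 in the bounds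
  that follow.\<close>

definition arcs :: "('v \<Rightarrow> 'v \<Rightarrow> bool) \<Rightarrow> 'v set \<Rightarrow> ('v \<times> 'v) set" where
  "arcs adj C = {(x, y). x \<in> C \<and> y \<in> C \<and> adj x y}"

lemma card_arcs_insert:
  assumes "symp adj" "irreflp adj" "finite C" "x \<notin> C"
  shows "card (arcs adj (insert x C)) = card (arcs adj C) + 2 * card {y\<in>C. adj x y}"
proof -
  let ?N = "{y\<in>C. adj x y}"
  have eq: "arcs adj (insert x C) = arcs adj C \<union> (Pair x ` ?N \<union> (\<lambda>y. (y, x)) ` ?N)"
    using assms(1,2) by (auto simp: arcs_def dest: sympD irreflpD)
  have fin: "finite (arcs adj C)"
    by (rule finite_subset[of _ "C \<times> C"]) (use assms(3) in \<open>auto simp: arcs_def\<close>)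
  have 1: "card (Pair x ` ?N \<union> (\<lambda>y. (y, x)) ` ?N) = card (Pair x ` ?N) + card ((\<lambda>y. (y, x)) ` ?N)"
    using assms(3,4) by (intro card_Un_disjoint) auto
  also have "\<dots> = card ?N + card ?N"
    by (intro arg_cong2[where f="(+)"] card_image) (auto simp: inj_on_def)
  finally show ?thesis unfolding eq using fin assms(3,4)
    by (subst card_Un_disjoint) (auto simp: arcs_def)
qed

text \<open>Removing a leaf loses at most one edge, so a nonempty forest on \<open>n\<close>
  vertices has at most \<open>n - 1\<close> edges.\<close>

lemma card_arcs_forest:
  assumes "symp adj" "irreflp adj" "\<nexists>p. graph_cycle adj p" "finite C" "C \<noteq> {}"
  shows "card (arcs adj C) + 2 \<le> 2 * card C"
  using assms(4,5)
proof (induction "card C" arbitrary: C rule: less_induct)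
  case less
  obtain x where x: "x \<in> C" "card {y\<in>C. adj x y} \<le> 1"
    using forest_leaf[OF assms(1-3) less.prems] by auto
  let ?D = "C - {x}"
  have ins: "insert x ?D = C" using x by auto
  have "card {y\<in>?D. adj x y} \<le> card {y\<in>C. adj x y}"
    using less.prems by (intro card_mono) auto
  then have le: "card {y\<in>?D. adj x y} \<le> 1" using x by simp
  have c: "card C = Suc (card ?D)" using x less.prems
    by (metis card.remove)
  have e: "card (arcs adj C) = card (arcs adj ?D) + 2 * card {y\<in>?D. adj x y}"
    using card_arcs_insert[OF assms(1,2), of ?D x] less.prems ins by simp
  show ?case
  proof (cases "?D = {}")
    case True
    then have "arcs adj ?D = {}" "card {y\<in>?D. adj x y} = 0" "card ?D = 0"
      unfolding True by (simp_all add: arcs_def)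
    then show ?thesis using e c by (simp only: card.empty)
  next
    case False
    then have "card (arcs adj ?D) + 2 \<le> 2 * card ?D"
      using less.hyps[of ?D] less.prems c by auto
    then show ?thesis using e c le by simp
  qed
qed

section \<open>Bootstrap percolation with threshold two\<close>

text \<open>A least fixed point replaces the discrete time of the infection: each infected vertex
  has a finite derivation and thus a finite cause.\<close>

inductive infected :: "('v \<Rightarrow> 'v \<Rightarrow> bool) \<Rightarrow> 'v set \<Rightarrow> 'v \<Rightarrow> bool" for adj B where
  init: "u \<in> B \<Longrightarrow> infected adj B u"
| spread: "adj u v \<Longrightarrow> adj u w \<Longrightarrow> v \<noteq> w \<Longrightarrow> infected adj B v \<Longrightarrow> infected adj B w \<Longrightarrow> infected adj B u"

text \<open>A finite set in \<open>spanned\<close> is filled by the infection without help from outside.\<close>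

inductive spanned :: "('v \<Rightarrow> 'v \<Rightarrow> bool) \<Rightarrow> 'v set \<Rightarrow> 'v set \<Rightarrow> bool" for adj B where
  empty: "spanned adj B {}"
| insert: "spanned adj B C \<Longrightarrow> x \<notin> C \<Longrightarrow> x \<in> B \<or> card {y\<in>C. adj x y} \<ge> 2 \<Longrightarrow>
    spanned adj B (insert x C)"

lemma spanned_finite: "spanned adj B C \<Longrightarrow> finite C"
  by (induction rule: spanned.induct) auto

text \<open>The vertices of \<open>D\<close> can be added after \<open>C\<close> in their old order,
  because a larger set only provides more neighbours.\<close>

lemma spanned_union:
  assumes "spanned adj B C" "spanned adj B D"
  shows "spanned adj B (C \<union> D)"
  using assms(2)
proof (induction rule: spanned.induct)
  case (insert D x)
  show ?case
  proof (cases "x \<in> C")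
    case True
    then show ?thesis using insert by (simp add: insert_absorb)
  next
    case False
    have "card {y\<in>D. adj x y} \<le> card {y\<in>C \<union> D. adj x y}"
      using spanned_finite[OF insert.hyps(1)] spanned_finite[OF assms(1)]
      by (intro card_mono) auto
    then have "spanned adj B (insert x (C \<union> D))"
      using insert False by (intro spanned.insert) auto
    then show ?thesis by simp
  qed
qed (use assms(1) in simp)

lemma infected_spanned:
  assumes "infected adj B u"
  shows "\<exists>C. spanned adj B C \<and> u \<in> C"
  using assms
proof (induction rule: infected.induct)
  case (init u)
  then show ?case
    using spanned.insert[OF spanned.empty, of u B adj] by auto
next
  case (spread u v w)
  then obtain C D where "spanned adj B C" "v \<in> C" "spanned adj B D" "w \<in> D" by auto
  then have E: "spanned adj B (C \<union> D)" "v \<in> C \<union> D" "w \<in> C \<union> D"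
    by (auto intro: spanned_union)
  have "card {v, w} \<le> card {y\<in>C \<union> D. adj u y}"
    using E spread by (intro card_mono) (auto dest: spanned_finite)
  then have "spanned adj B (insert u (C \<union> D))"
    using E spread by (cases "u \<in> C \<union> D") (auto intro: spanned.insert simp: insert_absorb)
  then show ?case by blast
qed

lemma infected_set_spanned:
  assumes "finite A" "\<And>u. u \<in> A \<Longrightarrow> infected adj B u"
  shows "\<exists>C. spanned adj B C \<and> A \<subseteq> C"
  using assms
proof (induction rule: finite_induct)
  case empty
  then show ?case by (auto intro: spanned.empty)
next
  case (insert x A)
  then obtain C D where "spanned adj B C" "A \<subseteq> C" "spanned adj B D" "x \<in> D"
    using infected_spanned by (metis insert_iff)
  then show ?case by (intro exI[of _ "C \<union> D"]) (auto intro: spanned_union)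
qed

text \<open>Within \<open>C\<close> no edge leads out of \<open>E\<close>, so the order that fills
  \<open>C\<close> also fills \<open>C \<inter> E\<close>.\<close>

lemma spanned_component:
  assumes "spanned adj B C" "\<And>x y. x \<in> C \<Longrightarrow> y \<in> C \<Longrightarrow> x \<in> E \<Longrightarrow> adj x y \<Longrightarrow> y \<in> E"
  shows "spanned adj B (C \<inter> E)"
  using assms
proof (induction rule: spanned.induct)
  case empty
  then show ?case by (simp add: spanned.empty)
next
  case (insert C x)
  have IH: "spanned adj B (C \<inter> E)" using insert.prems by (intro insert.IH) blast
  show ?case
  proof (cases "x \<in> E")
    case True
    then have "{y\<in>C \<inter> E. adj x y} = {y\<in>C. adj x y}" using insert.prems by blast
    then have "spanned adj B (insert x (C \<inter> E))"
      using insert.hyps IH by (intro spanned.insert) auto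
    then show ?thesis using True by simp
  qed (use IH in simp)
qed

text \<open>A vertex added by the rule brings at least two edges, hence four arcs; an initially
  infected one is paid for by the second summand.\<close>

lemma spanned_arcs:
  assumes "symp adj" "irreflp adj" "spanned adj B C"
  shows "4 * card C \<le> card (arcs adj C) + 4 * card (C \<inter> B)"
  using assms(3)
proof (induction rule: spanned.induct)
  case (insert C x)
  have fin: "finite C" using insert.hyps(1) by (rule spanned_finite)
  show ?case
    using insert card_arcs_insert[OF assms(1,2) fin, of x] fin
    by (cases "x \<in> B") auto
qed simp

text \<open>Each infection step in a spanned set closes two edges, and a forest has too few of them
  for more than half of the vertices to be infected that way.\<close>

lemma spanned_density:
  assumes "symp adj" "irreflp adj" "\<nexists>p. graph_cycle adj p" "spanned adj B C"
  shows "card C \<le> 2 * card (C \<inter> B)"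
proof (cases "C = {}")
  case False
  then show ?thesis
    using spanned_arcs[OF assms(1,2,4)] card_arcs_forest[OF assms(1-3) _ False]
      spanned_finite[OF assms(4)] by linarith
qed simp

text \<open>Infection runs in the forest \<open>adj\<close>, while clusters are connected in the
  larger graph \<open>adj'\<close>. A spanned set covering a large animal is cut down to the part
  reachable from \<open>u\<close> along \<open>adj'\<close>; inside the set this part is closed
  under \<open>adj\<close>, so it stays spanned and the density bound applies to it.\<close>

lemma infected_animal:
  assumes "symp adj" "irreflp adj" "\<nexists>p. graph_cycle adj p"
    and "\<And>x y. adj x y \<Longrightarrow> adj' x y"
    and "infinite (reach adj' Y u)" "\<And>x. x \<in> reach adj' Y u \<Longrightarrow> infected adj B x" "n \<ge> 1"
  shows "\<exists>C. animal adj' u C \<and> card C \<ge> n \<and> card C \<le> 2 * card (C \<inter> B)"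
proof -
  obtain A where A: "animal adj' u A" "A \<subseteq> reach adj' Y u" "card A = n"
    using animal_in_reach[OF assms(7) disjI1[OF assms(5)]] by blast
  obtain C where C: "spanned adj B C" "A \<subseteq> C"
    using infected_set_spanned[of A adj B] A assms(6) animal_finite[OF A(1)] by (metis subsetD)
  have uC: "u \<in> C" using animal_root[OF A(1)] C(2) by blast
  let ?E = "reach adj' C u"
  have sub: "?E \<subseteq> C" using uC by (rule reach_sub)
  have "spanned adj B (C \<inter> ?E)"
    using C(1) by (rule spanned_component) (auto intro: reach_step assms(4))
  then have sp: "spanned adj B ?E" using sub by (simp add: Int_absorb1)
  have "A \<subseteq> ?E" using animal_reach[OF A(1) C(2)] .
  then have "n \<le> card ?E" using A(3) card_mono[OF spanned_finite[OF sp]] by blast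
  moreover have "animal adj' u ?E" using spanned_finite[OF sp] by (rule finite_reach_animal)
  ultimately show ?thesis using spanned_density[OF assms(1-3) sp] by blast
qed

section \<open>The graphical construction\<close>

lemma nat_eqI: "(\<And>n::nat. n < a \<longleftrightarrow> n < b) \<Longrightarrow> a = b"
  by (metis less_irrefl linorder_neqE_nat)

lemma majority_update_cong:
  assumes "\<And>y. adj x y \<Longrightarrow> \<eta> y = \<zeta> y"
  shows "majority_update adj \<eta> c x = majority_update adj \<zeta> c x"
proof -
  have "{y. adj x y \<and> \<eta> y = s} = {y. adj x y \<and> \<zeta> y = s}" for s
    using assms by auto
  then show ?thesis by (simp add: majority_update_def)
qed

lemma majority_update_Plus:
  assumes "finite {y. adj x y}" "2 * card {y\<in>S. adj x y} > card {y. adj x y}"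
    and "\<And>y. y \<in> S \<Longrightarrow> adj x y \<Longrightarrow> \<eta> y = Plus"
  shows "majority_update adj \<eta> c x = Plus"
proof -
  let ?P = "{y. adj x y \<and> \<eta> y = Plus}" and ?M = "{y. adj x y \<and> \<eta> y = Minus}"
  have "?P \<union> ?M = {y. adj x y}" using spin.exhaust by auto
  then have fin: "finite ?P" "finite ?M" and "card (?P \<union> ?M) = card {y. adj x y}"
    using assms(1) by (auto intro: finite_subset)
  moreover have "card (?P \<union> ?M) = card ?P + card ?M"
    using fin by (intro card_Un_disjoint) auto
  moreover have "card {y\<in>S. adj x y} \<le> card ?P"
    using fin assms(3) by (intro card_mono) auto
  ultimately have "card ?M < card ?P" using assms(2) by linarith
  then show ?thesis by (simp add: majority_update_def)
qed

text \<open>Local finiteness of the backward influence is stated as the absence of infinite backward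
  chains of rings.\<close>

locale clocks =
  fixes adj :: "'x \<Rightarrow> 'x \<Rightarrow> bool" and ring :: "'x \<Rightarrow> nat \<Rightarrow> real"
  assumes finite_nbrs: "finite {y. adj x y}"
    and ring_mono: "strict_mono (ring x)"
    and ring_pos: "0 < ring x 0"
    and ring_unbounded: "\<exists>n. t < ring x n"
    and no_chain: "\<nexists>x n. \<forall>i. adj (x i) (x (Suc i)) \<and> ring (x (Suc i)) (n (Suc i)) < ring (x i) (n i)"
begin

text \<open>As rings are numbered from 0 and increase, the least index of a later ring is the number
  of rings up to and including time \<open>t\<close>. The companion \<open>before\<close> leaves out
  a ring at \<open>t\<close> itself, as left limits require.\<close>

definition upto :: "'x \<Rightarrow> real \<Rightarrow> nat" where
  "upto x t = (LEAST n. t < ring x n)"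

definition before :: "'x \<Rightarrow> real \<Rightarrow> nat" where
  "before x t = (LEAST n. t \<le> ring x n)"

lemma ring_le_iff: "ring x m \<le> ring x n \<longleftrightarrow> m \<le> n"
  by (rule strict_mono_less_eq[OF ring_mono])

lemma less_upto: "n < upto x t \<longleftrightarrow> ring x n \<le> t"
proof
  show "n < upto x t \<Longrightarrow> ring x n \<le> t"
    unfolding upto_def using not_less_Least by (metis not_le)
  have "t < ring x (upto x t)"
    unfolding upto_def using ring_unbounded by (rule LeastI_ex)
  then show "ring x n \<le> t \<Longrightarrow> n < upto x t"
    using ring_le_iff[of x "upto x t" n] by (metis not_le order_less_le_trans)
qed

lemma less_before: "n < before x t \<longleftrightarrow> ring x n < t"
proof
  show "n < before x t \<Longrightarrow> ring x n < t"
    unfolding before_def using not_less_Least by (metis not_le)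
  have "t \<le> ring x (before x t)"
    unfolding before_def using ring_unbounded by (metis LeastI_ex less_imp_le)
  then show "ring x n < t \<Longrightarrow> n < before x t"
    using ring_le_iff[of x "before x t" n] by (metis not_le order_less_le_trans)
qed

lemma upto_nonpos: "t \<le> 0 \<Longrightarrow> upto x t = 0"
  using less_upto[of 0 x t] ring_pos[of x] by auto

lemma ring_pos': "0 < ring x n"
  using ring_pos[of x] ring_le_iff[of x 0 n] by linarith

lemma upto_ring: "upto x (ring x n) = Suc n"
  by (rule nat_eqI) (auto simp: less_upto ring_le_iff)

text \<open>The last ring before \<open>r\<close>, if any, leaves a gap to the left of
  \<open>r\<close> in which \<open>y\<close> does not ring.\<close>

lemma upto_before: "\<forall>\<^sub>F s in at_left r. upto y s = before y r"
proof (cases "before y r")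
  case 0
  have "\<forall>\<^sub>F s in at_left r. s < r" by (simp add: eventually_at_filter)
  then show ?thesis
  proof eventually_elim
    case (elim s)
    then have "ring y n \<le> s \<Longrightarrow> n < before y r" for n by (simp add: less_before)
    then show ?case using 0 less_upto by (metis gr0I not_less_zero)
  qed
next
  case (Suc m)
  then have "ring y m < r" by (metis less_before lessI)
  then have "\<forall>\<^sub>F s in at_left r. s \<in> {ring y m<..<r}" by (rule eventually_at_left_real)
  then show ?thesis
  proof eventually_elim
    case (elim s)
    have "ring y n \<le> s \<longleftrightarrow> ring y n < r" for n
      using elim less_before[of n y r] ring_le_iff[of y n m] unfolding Suc by auto
    then show ?case by (intro nat_eqI) (simp add: less_upto less_before)
  qed
qed

lemma nbrs_before:
  "\<forall>\<^sub>F s in at_left (ring x n). 0 \<le> s \<and> (\<forall>y. adj x y \<longrightarrow> upto y s = before y (ring x n))"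
proof -
  have "\<forall>\<^sub>F s in at_left (ring x n). \<forall>y\<in>{y. adj x y}. upto y s = before y (ring x n)"
    by (rule eventually_ball_finite[OF finite_nbrs]) (simp add: upto_before)
  moreover have "\<forall>\<^sub>F s in at_left (ring x n). s \<in> {0<..<ring x n}"
    by (rule eventually_at_left_real[OF ring_pos'])
  ultimately show ?thesis by eventually_elim auto
qed

section \<open>Well-founded recursion over the rings\<close>

text \<open>The pair \<open>(x, k)\<close> stands for \<open>x\<close> after \<open>k\<close> rings.
  Ring \<open>n\<close> produces \<open>(x, Suc n)\<close> from the spins of the neighbours just
  before it; pairs with index 0 are initial spins and have no predecessor.\<close>

definition influence :: "(('x \<times> nat) \<times> ('x \<times> nat)) set" where
  "influence = {((y, before y (ring x n)), (x, Suc n)) | x y n. adj x y}"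

lemma wf_influence: "wf influence"
  unfolding wf_iff_no_infinite_down_chain
proof
  assume "\<exists>f. \<forall>i. (f (Suc i), f i) \<in> influence"
  then obtain f where f: "\<And>i. (f (Suc i), f i) \<in> influence" by auto
  \<comment> \<open>Every \<open>f i\<close> has a predecessor, so its index is positive, and
    \<open>n i\<close> is the ring that produced it.\<close>
  define x n where "x = fst \<circ> f" and "n i = snd (f i) - 1" for i
  have f_eq: "f i = (x i, Suc (n i))" for i
    using f[of i] by (auto simp: influence_def x_def n_def)
  have "adj (x i) (x (Suc i)) \<and> Suc (n (Suc i)) = before (x (Suc i)) (ring (x i) (n i))" for i
    using f[of i] f_eq[of i] f_eq[of "Suc i"] by (auto simp: influence_def)
  then have "adj (x i) (x (Suc i)) \<and> ring (x (Suc i)) (n (Suc i)) < ring (x i) (n i)" for i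
    by (metis less_before lessI)
  then show False using no_chain by blast
qed

text \<open>An update ignores the old spin of \<open>x\<close> itself and looks back in time at the
  neighbours, so the recursion descends along \<open>influence\<close> rather than along
  \<open>k\<close>.\<close>

definition state :: "('x \<Rightarrow> spin) \<Rightarrow> ('x \<Rightarrow> nat \<Rightarrow> spin) \<Rightarrow> 'x \<times> nat \<Rightarrow> spin" where
  "state init coin = wfrec influence (\<lambda>f (x, k). case k of 0 \<Rightarrow> init x
     | Suc n \<Rightarrow> majority_update adj (\<lambda>y. f (y, before y (ring x n))) (coin x n) x)"

lemma state_0: "state init coin (x, 0) = init x"
  unfolding state_def by (subst wfrec[OF wf_influence]) simp

text \<open>The operator \<open>wfrec\<close> cuts its function off outside the predecessors; the
  update reads only neighbours, where nothing is cut.\<close>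

lemma state_Suc: "state init coin (x, Suc n) =
  majority_update adj (\<lambda>y. state init coin (y, before y (ring x n))) (coin x n) x"
  unfolding state_def
  by (subst wfrec[OF wf_influence], simp, rule majority_update_cong)
     (auto simp: cut_apply influence_def)

definition trajectory :: "('x \<Rightarrow> spin) \<Rightarrow> ('x \<Rightarrow> nat \<Rightarrow> spin) \<Rightarrow> 'x \<Rightarrow> real \<Rightarrow> spin" where
  "trajectory init coin x t = state init coin (x, upto x t)"

lemma trajectory_ring:
  "\<forall>\<^sub>F s in at_left (ring x n). trajectory init coin x (ring x n) =
     majority_update adj (\<lambda>y. trajectory init coin y s) (coin x n) x"
  using nbrs_before
proof eventually_elim
  case (elim s)
  show ?case unfolding trajectory_def upto_ring state_Suc
    by (rule majority_update_cong) (use elim in auto)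
qed

lemma majority_trajectory_trajectory:
  "majority_trajectory adj init ring coin (trajectory init coin)"
  unfolding majority_trajectory_def
proof (intro conjI allI impI)
  show "t \<le> 0 \<Longrightarrow> trajectory init coin x t = init x" for x t
    by (simp add: trajectory_def upto_nonpos state_0)
  show "trajectory init coin x t = trajectory init coin x s"
    if "0 \<le> s \<and> s < t \<and> (\<forall>n. ring x n \<notin> {s<..t})" for x s t
  proof -
    have "ring x n \<le> t \<longleftrightarrow> ring x n \<le> s" for n using that by force
    then have "upto x t = upto x s" by (intro nat_eqI) (simp add: less_upto)
    then show ?thesis by (simp add: trajectory_def)
  qed
qed (rule trajectory_ring)

text \<open>Induction along \<open>influence\<close> shows that \<open>\<sigma>\<close> has the spin
  \<open>state init coin (x, k)\<close> whenever \<open>x\<close> has rung \<open>k\<close> times: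
  it is constant between rings, and at a ring the spins of the neighbours are known by
  induction.\<close>

lemma majority_trajectory_unique:
  assumes "majority_trajectory adj init ring coin \<sigma>"
  shows "\<sigma> = trajectory init coin"
proof -
  have init: "\<sigma> x t = init x" if "t \<le> 0" for x t
    using assms that by (simp add: majority_trajectory_def)
  have const: "\<sigma> x t = \<sigma> x s" if "0 \<le> s" "s \<le> t" "\<And>n. ring x n \<notin> {s<..t}" for x s t
    using assms that unfolding majority_trajectory_def by (metis order_le_less)
  have jump: "\<forall>\<^sub>F s in at_left (ring x n).
      \<sigma> x (ring x n) = majority_update adj (\<lambda>y. \<sigma> y s) (coin x n) x" for x n
    using assms by (simp add: majority_trajectory_def)
  have main: "\<forall>t\<ge>0. upto (fst p) t = snd p \<longrightarrow> \<sigma> (fst p) t = state init coin p" for p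
  proof (induction p rule: wf_induct_rule[OF wf_influence])
    case (1 p)
    obtain x k where p: "p = (x, k)" by fastforce
    have "\<sigma> x t = state init coin (x, k)" if t: "0 \<le> t" "upto x t = k" for t
    proof (cases k)
      case 0
      then have "ring x n \<notin> {0<..t}" for n using t less_upto[of n x t] by auto
      then have "\<sigma> x t = \<sigma> x 0" using t by (intro const) auto
      then show ?thesis using 0 by (simp add: init state_0)
    next
      case (Suc n)
      have upt: "m \<le> n \<longleftrightarrow> ring x m \<le> t" for m
        using less_upto[of m x t] t Suc by (simp add: less_Suc_eq_le)
      then have "ring x m \<notin> {ring x n<..t}" for m
        using ring_le_iff[of x m n] by auto
      moreover have "ring x n \<le> t" using upt by blast
      ultimately have "\<sigma> x t = \<sigma> x (ring x n)"
        using ring_pos'[of x n] by (intro const) auto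
      also have "\<forall>\<^sub>F s in at_left (ring x n).
          \<sigma> x (ring x n) = state init coin (x, Suc n)"
        using jump nbrs_before
      proof eventually_elim
        case (elim s)
        have "\<sigma> y s = state init coin (y, before y (ring x n))" if "adj x y" for y
          using 1[of "(y, before y (ring x n))"] that elim
          by (auto simp: p Suc influence_def)
        then show ?case using elim unfolding state_Suc
          by (simp cong: majority_update_cong)
      qed
      \<comment> \<open>Neither side depends on \<open>s\<close>, and the filter
        \<open>at_left\<close> is nontrivial, so the eventual equation is an equation.\<close>
      then have "\<sigma> x (ring x n) = state init coin (x, Suc n)"
        by (simp add: eventually_const_iff)
      finally show ?thesis using Suc by simp
    qed
    then show ?case by (simp add: p)
  qed
  show ?thesis
  proof (intro ext)
    fix x t
    show "\<sigma> x t = trajectory init coin x t"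
      using main[of "(x, upto x t)"] init[of t x]
      by (cases "t \<le> 0") (auto simp: trajectory_def upto_nonpos state_0)
  qed
qed

lemma the_trajectory: "(THE \<sigma>. majority_trajectory adj init ring coin \<sigma>) = trajectory init coin"
  by (rule the_equality) (auto intro: majority_trajectory_trajectory majority_trajectory_unique)

section \<open>Persistence of Plus spins\<close>

text \<open>The neighbours in \<open>S\<close> win every vote without a tie, so by induction along
  \<open>influence\<close> no ring brings a Minus into \<open>S\<close>.\<close>

lemma trajectory_stable:
  assumes "\<And>x. x \<in> S \<Longrightarrow> init x = Plus"
    and "\<And>x. x \<in> S \<Longrightarrow> card {y. adj x y} < 2 * card {y\<in>S. adj x y}" and "x \<in> S"
  shows "trajectory init coin x t = Plus"
proof -
  have "fst p \<in> S \<longrightarrow> state init coin p = Plus" for p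
  proof (induction p rule: wf_induct_rule[OF wf_influence])
    case (1 p)
    obtain x k where p: "p = (x, k)" by fastforce
    show ?case
    proof (cases k)
      case 0
      then show ?thesis using assms(1) by (simp add: p state_0)
    next
      case (Suc n)
      have "state init coin (x, Suc n) = Plus" if "x \<in> S"
        unfolding state_Suc using finite_nbrs assms(2)[OF that]
      proof (rule majority_update_Plus)
        fix y assume "y \<in> S" "adj x y"
        then show "state init coin (y, before y (ring x n)) = Plus"
          using 1[of "(y, before y (ring x n))"] by (auto simp: p Suc influence_def)
      qed
      then show ?thesis by (simp add: p Suc)
    qed
  qed
  then show ?thesis using assms(3) by (simp add: trajectory_def)
qed

definition fixated :: "('x \<Rightarrow> spin) \<Rightarrow> ('x \<Rightarrow> nat \<Rightarrow> spin) \<Rightarrow> 'x set" where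
  "fixated init coin = {x. \<exists>T. \<forall>t\<ge>T. trajectory init coin x t = Plus}"

text \<open>The finitely many fixated neighbours are all Plus from a common time \<open>T\<close>
  on, so every ring of \<open>x\<close> after \<open>T\<close> yields Plus, and such a ring
  exists.\<close>

lemma fixated_majority:
  assumes "card {y. adj x y} < 2 * card {y\<in>fixated init coin. adj x y}"
  shows "x \<in> fixated init coin"
proof -
  let ?N = "{y\<in>fixated init coin. adj x y}"
  have "\<forall>y\<in>?N. \<forall>\<^sub>F t in at_top. trajectory init coin y t = Plus"
    by (auto simp: fixated_def eventually_at_top_linorder)
  then have "\<forall>\<^sub>F t in at_top. \<forall>y\<in>?N. trajectory init coin y t = Plus"
    using finite_nbrs[of x] by (intro eventually_ball_finite) (auto intro: finite_subset)
  then obtain T where T: "\<And>t y. t \<ge> T \<Longrightarrow> y \<in> ?N \<Longrightarrow> trajectory init coin y t = Plus"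
    by (auto simp: eventually_at_top_linorder)
  obtain n where n: "T < ring x n" using ring_unbounded by blast
  have Plus: "state init coin (x, Suc m) = Plus" if "m \<ge> n" for m
  proof -
    have "T < ring x m" using n that ring_le_iff[of x n m] by linarith
    then have "\<forall>\<^sub>F s in at_left (ring x m). s \<in> {T<..<ring x m}" by (rule eventually_at_left_real)
    then have "\<forall>\<^sub>F s in at_left (ring x m). trajectory init coin x (ring x m) = Plus"
      using trajectory_ring[of init coin x m]
    proof eventually_elim
      case (elim s)
      then show ?case using finite_nbrs assms T
        by (auto intro!: majority_update_Plus[where S="fixated init coin"])
    qed
    then have "trajectory init coin x (ring x m) = Plus" by (simp add: eventually_const_iff)
    then show ?thesis by (simp add: trajectory_def upto_ring)
  qed
  have "trajectory init coin x t = Plus" if "t \<ge> ring x n" for t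
  proof -
    have "n < upto x t" using that by (simp add: less_upto)
    moreover from this obtain m where "upto x t = Suc m" by (cases "upto x t") auto
    ultimately show ?thesis using Plus by (simp add: trajectory_def)
  qed
  then show ?thesis by (auto simp: fixated_def)
qed

end

section \<open>Rare events along connected sets\<close>

text \<open>There are at most \<open>D ^ (2 * m)\<close> animals of size \<open>m\<close>, so an
  event of that size occurs with probability at most \<open>(real D ^ 2 * c) ^ m\<close>. This is
  summable, and the Borel-Cantelli lemma leaves only finitely many sizes.\<close>

lemma animal_borel_cantelli:
  fixes c :: real
  assumes "prob_space M" "symp adj" "\<And>u. finite {v. adj u v}" "\<And>u. card {v. adj u v} \<le> D" "1 \<le> D"
    and c: "0 \<le> c" "real D ^ 2 * c < 1"
    and ev: "\<And>C. animal adj u C \<Longrightarrow> Ev C \<in> sets M"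
      "\<And>C. animal adj u C \<Longrightarrow> measure M (Ev C) \<le> c ^ card C"
  shows "AE \<omega> in M. \<exists>N. \<forall>C. animal adj u C \<and> card C \<ge> N \<longrightarrow> \<omega> \<notin> Ev C"
proof -
  interpret prob_space M by fact
  let ?An = "\<lambda>m. {C. animal adj u C \<and> card C = m}"
  define A where "A m = (\<Union>C\<in>?An m. Ev C)" for m
  have empty: "?An 0 = {}"
    using animal_root animal_finite by fastforce
  have fin: "finite (?An m)" for m
  proof (cases "m = 0")
    case True
    then show ?thesis using empty by (simp only: finite.emptyI)
  next
    case False
    then show ?thesis by (intro card_animals(1)[OF assms(2-4)]) simp
  qed
  have cnt: "card (?An m) \<le> D ^ (2 * m)" for m
  proof (cases m)
    case (Suc n)
    have "card (?An m) \<le> D ^ (2 * m - 2)"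
      using card_animals(2)[OF assms(2-4), of m u] Suc by simp
    also have "\<dots> \<le> D ^ (2 * m)" using assms(5) by (intro power_increasing) auto
    finally show ?thesis .
  next
    case 0
    show ?thesis unfolding 0 empty by simp
  qed
  have meas: "A m \<in> sets M" for m unfolding A_def using fin ev(1) by (intro sets.finite_UN) auto
  have le: "prob (A m) \<le> (real D ^ 2 * c) ^ m" for m
  proof -
    have "prob (A m) \<le> (\<Sum>C\<in>?An m. prob (Ev C))"
      unfolding A_def using fin ev(1) by (intro measure_UNION_le) auto
    also have "\<dots> \<le> (\<Sum>C\<in>?An m. c ^ m)" using ev(2) by (intro sum_mono) auto
    also have "\<dots> = real (card (?An m)) * c ^ m" by simp
    also have "\<dots> \<le> real (D ^ (2 * m)) * c ^ m"
      using cnt c by (intro mult_right_mono) (simp_all only: of_nat_le_iff zero_le_power)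
    finally show ?thesis by (simp add: power_mult power_mult_distrib)
  qed
  have "summable (\<lambda>m. prob (A m))"
    using c le by (intro summable_comparison_test'[OF summable_geometric[of "real D ^ 2 * c"]]) auto
  then have "AE \<omega> in M. \<forall>\<^sub>F m in sequentially. \<omega> \<in> space M - A m"
    using meas by (intro borel_cantelli_AE1) (auto simp: emeasure_eq_measure)
  then show ?thesis
    by eventually_elim (auto simp: eventually_sequentially A_def)
qed

section \<open>The clock rings\<close>

abbreviation exp_law :: "real measure" where
  "exp_law \<equiv> density lborel (exponential_density 1)"

lemma prob_space_exp_law: "prob_space exp_law"
  by (rule prob_space_exponential_density) simp

lemma product_prob_space_waiting: "product_prob_space (\<lambda>_. exp_law)"
  by (intro product_prob_spaceI prob_space_exp_law)

lemma prob_space_waiting: "prob_space waiting_law"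
  unfolding waiting_law_def by (intro prob_space_PiM prob_space_exp_law)

lemma space_waiting: "space waiting_law = UNIV"
  by (simp add: waiting_law_def space_PiM)

lemma sets_waiting: "sets waiting_law = sets (\<Pi>\<^sub>M i\<in>UNIV. borel)"
  unfolding waiting_law_def by (intro sets_PiM_cong) simp_all

lemma measurable_waiting [measurable]: "(\<lambda>w. w i) \<in> borel_measurable waiting_law"
  unfolding measurable_cong_sets[OF sets_waiting refl] by simp

lemma measurable_ring_time [measurable]: "(\<lambda>w. ring_time w x n) \<in> borel_measurable waiting_law"
  unfolding ring_time_def by measurable

lemma distr_waiting: "distr waiting_law borel (\<lambda>w. w i) = exp_law"
proof -
  interpret product_prob_space "\<lambda>_. exp_law" UNIV by (rule product_prob_space_waiting)
  have "distr waiting_law borel (\<lambda>w. w i) = distr (PiM UNIV (\<lambda>_. exp_law)) exp_law (\<lambda>w. w i)"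
    unfolding waiting_law_def by (intro distr_cong) simp_all
  then show ?thesis using PiM_component[of i] by simp
qed

lemma distributed_waiting: "distributed waiting_law lborel (\<lambda>w. w i) (exponential_density 1)"
proof -
  have "distr waiting_law lborel (\<lambda>w. w i) = exp_law"
    using distr_waiting[of i] by (metis distr_cong sets_lborel)
  then show ?thesis by (simp add: distributed_def)
qed

lemma indep_waiting: "prob_space.indep_vars waiting_law (\<lambda>_. borel) (\<lambda>i w. w i) UNIV"
proof -
  interpret prob_space waiting_law by (rule prob_space_waiting)
  have "distr waiting_law (\<Pi>\<^sub>M i\<in>UNIV. borel) (\<lambda>w. \<lambda>i\<in>UNIV. w i) = waiting_law"
    unfolding restrict_UNIV by (rule distr_id2) (rule sets_waiting[symmetric])
  then show ?thesis
    by (subst indep_vars_iff_distr_eq_PiM) (simp_all add: distr_waiting, simp add: waiting_law_def)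
qed

text \<open>Ring \<open>n\<close> is the sum of \<open>n + 1\<close> independent exponential waiting
  times, and the first argument of \<open>erlang_density\<close> is the number of summands minus
  one.\<close>

lemma distributed_ring_time:
  "distributed waiting_law lborel (\<lambda>w. ring_time w x n) (erlang_density n 1)"
proof -
  interpret prob_space waiting_law by (rule prob_space_waiting)
  have "distributed waiting_law lborel (\<lambda>w. \<Sum>p\<in>Pair x ` {..n}. w p)
      (erlang_density (card (Pair x ` {..n}) - 1) 1)"
    using indep_vars_subset[OF indep_waiting, of "Pair x ` {..n}"]
    by (intro exponential_distributed_sum) (auto intro: distributed_waiting)
  moreover have "card (Pair x ` {..n}) = Suc n"
    by (subst card_image) (auto simp: inj_on_def)
  ultimately show ?thesis
    by (simp add: ring_time_def sum.reindex inj_on_def)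
qed

text \<open>For \<open>t \<ge> 0\<close> these are the Poisson weights
  \<open>t ^ n / fact n * exp (- t)\<close>, which add up to one.\<close>

lemma suminf_erlang: "(\<Sum>n. ennreal (erlang_density n 1 t)) = indicator {0..} t"
proof (cases "t < 0")
  case False
  have "(\<lambda>n. t ^ n /\<^sub>R fact n * exp (- t)) sums (exp t * exp (- t))"
    by (intro sums_mult2 exp_converges)
  then have "(\<lambda>n. erlang_density n 1 t) sums 1"
    using False by (simp add: erlang_density_def exp_minus field_simps)
  then have "(\<Sum>n. ennreal (erlang_density n 1 t)) = ennreal 1"
    by (rule suminf_ennreal_eq[rotated]) simp
  then show ?thesis using False by simp
qed (simp add: erlang_density_def)

text \<open>The rings of a vertex have intensity one, since the Erlang densities add up to one.\<close>

lemma suminf_ring_time: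
  assumes "A \<in> sets borel"
  shows "(\<Sum>n. emeasure waiting_law {w. ring_time w x n \<in> A}) = emeasure lborel (A \<inter> {0..})"
proof -
  have "emeasure waiting_law {w. ring_time w x n \<in> A} =
      (\<integral>\<^sup>+t. ennreal (erlang_density n 1 t) * indicator A t \<partial>lborel)" for n
    using distributed_emeasure[OF distributed_ring_time, of A x n] assms
    by (simp add: space_waiting vimage_def)
  then have "(\<Sum>n. emeasure waiting_law {w. ring_time w x n \<in> A}) =
      (\<Sum>n. \<integral>\<^sup>+t. ennreal (erlang_density n 1 t) * indicator A t \<partial>lborel)" by simp
  also have "\<dots> = (\<integral>\<^sup>+t. (\<Sum>n. ennreal (erlang_density n 1 t) * indicator A t) \<partial>lborel)"
    using assms by (intro nn_integral_suminf[symmetric]) auto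
  also have "\<dots> = (\<integral>\<^sup>+t. indicator (A \<inter> {0..}) t \<partial>lborel)"
    by (intro nn_integral_cong) (simp add: ennreal_suminf_multc suminf_erlang indicator_inter_arith mult.commute)
  also have "\<dots> = emeasure lborel (A \<inter> {0..})" using assms by simp
  finally show ?thesis .
qed

lemma sets_ring_in [measurable]:
  "A \<in> sets borel \<Longrightarrow> {w. ring_time w x n \<in> A} \<in> sets waiting_law"
  using measurable_sets[OF measurable_ring_time, of A x n] by (simp add: space_waiting vimage_def)

lemma sets_ex_ring_in:
  assumes "A \<in> sets borel"
  shows "{w. \<exists>n. ring_time w x n \<in> A} \<in> sets waiting_law"
proof -
  have "{w. \<exists>n. ring_time w x n \<in> A} = (\<Union>n. {w. ring_time w x n \<in> A})" by auto
  also have "\<dots> \<in> sets waiting_law"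
    using assms by (intro sets.countable_UN image_subsetI sets_ring_in)
  finally show ?thesis .
qed

text \<open>The expected number of rings in an interval is its length, and it bounds the probability
  of at least one ring.\<close>

lemma prob_ex_ring_in:
  assumes "0 \<le> a" "a \<le> b"
  shows "measure waiting_law {w. \<exists>n. ring_time w x n \<in> {a..<b}} \<le> b - a"
proof -
  have "emeasure waiting_law (\<Union>n. {w. ring_time w x n \<in> {a..<b}})
      \<le> (\<Sum>n. emeasure waiting_law {w. ring_time w x n \<in> {a..<b}})"
    by (intro emeasure_subadditive_countably image_subsetI sets_ring_in) simp
  also have "\<dots> = emeasure lborel ({a..<b} \<inter> {0..})" by (rule suminf_ring_time) simp
  also have "{a..<b} \<inter> {0..} = {a..<b}" using assms by auto
  also have "emeasure lborel {a..<b} = ennreal (b - a)" using assms by simp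
  finally show ?thesis using assms
    by (simp add: measure_def UNION_eq enn2real_leI)
qed

text \<open>The expected number of rings up to a time \<open>k\<close> is finite, so by
  Borel-Cantelli almost surely only finitely many occur there.\<close>

lemma AE_ring_unbounded: "AE w in waiting_law. \<forall>t. \<exists>n. t < ring_time w x n"
proof -
  interpret prob_space waiting_law by (rule prob_space_waiting)
  have "AE w in waiting_law. \<exists>n. real k < ring_time w x n" for k
  proof -
    let ?A = "\<lambda>n. {w. ring_time w x n \<in> {..real k}}"
    have "(\<Sum>n. ennreal (prob (?A n))) = emeasure lborel ({..real k} \<inter> {0..})"
      by (subst suminf_ring_time[symmetric]) (simp_all only: emeasure_eq_measure, simp)
    also have "{..real k} \<inter> {0..} = {0..real k}" by auto
    finally have "(\<Sum>n. ennreal (prob (?A n))) \<noteq> top" by simp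
    then have "summable (\<lambda>n. prob (?A n))" by (intro summable_suminf_not_top) auto
    then have "AE w in waiting_law. \<forall>\<^sub>F n in sequentially. w \<in> space waiting_law - ?A n"
      by (intro borel_cantelli_AE1 sets_ring_in) (simp_all add: emeasure_eq_measure)
    then show ?thesis by eventually_elim (auto simp: eventually_sequentially not_le)
  qed
  then have "AE w in waiting_law. \<forall>k. \<exists>n. real k < ring_time w x n" by (subst AE_all_countable) simp
  then show ?thesis
  proof eventually_elim
    case (elim w)
    then show ?case using reals_Archimedean2 by (meson less_trans)
  qed
qed

lemma AE_waiting_pos: "AE w in waiting_law. 0 < w i"
proof -
  have "AE t in exp_law. 0 < t"
  proof (subst AE_density)
    have "AE t in lborel. t \<noteq> (0::real)" by (rule AE_lborel_singleton)
    then show "AE t in lborel. 0 < ennreal (exponential_density 1 t) \<longrightarrow> 0 < t"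
      by eventually_elim (auto simp: exponential_density_def)
  qed simp
  then have "AE t in distr waiting_law borel (\<lambda>w. w i). 0 < t" unfolding distr_waiting .
  then show ?thesis by (rule AE_distrD[rotated]) simp
qed

text \<open>Different vertices use disjoint families of waiting times, so their events are
  independent.\<close>

lemma prob_all_ring_in:
  assumes "0 \<le> a" "a \<le> b" "finite C"
  shows "{w. \<forall>x\<in>C. \<exists>n. ring_time w x n \<in> {a..<b}} \<in> sets waiting_law"
    "measure waiting_law {w. \<forall>x\<in>C. \<exists>n. ring_time w x n \<in> {a..<b}} \<le> (b - a) ^ card C"
proof -
  interpret prob_space waiting_law by (rule prob_space_waiting)
  let ?E = "\<lambda>x. {w. \<exists>n. ring_time w x n \<in> {a..<b}}"
  have eq: "{w. \<forall>x\<in>C. \<exists>n. ring_time w x n \<in> {a..<b}} = (\<Inter>x\<in>C. ?E x)" by auto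
  have E: "?E x \<in> sets waiting_law" for x by (rule sets_ex_ring_in) simp
  show "{w. \<forall>x\<in>C. \<exists>n. ring_time w x n \<in> {a..<b}} \<in> sets waiting_law"
  proof (cases "C = {}")
    case True
    then show ?thesis using sets.top[of waiting_law] by (simp add: space_waiting)
  next
    case False
    then show ?thesis using E assms(3) unfolding eq by (intro sets.finite_INT)
  qed
  show "prob {w. \<forall>x\<in>C. \<exists>n. ring_time w x n \<in> {a..<b}} \<le> (b - a) ^ card C"
  proof (cases "C = {}")
    case False
    \<comment> \<open>\<open>?K x\<close> lists the coordinates of the clock of \<open>x\<close>;
      \<open>?S x\<close> is the event that \<open>x\<close> rings in the slice, written in these
      coordinates only.\<close>
    let ?K = "\<lambda>x. {x} \<times> (UNIV :: nat set)"
    let ?S = "\<lambda>x. {v\<in>space (PiM (?K x) (\<lambda>_. borel)). \<exists>n. (\<Sum>i\<le>n. v (x, i)) \<in> {a..<b}}"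
    have ind: "indep_vars (\<lambda>x. PiM (?K x) (\<lambda>_. borel)) (\<lambda>x w. restrict (\<lambda>i. w i) (?K x)) C"
      by (rule indep_vars_restrict[OF indep_waiting]) (auto simp: disjoint_family_on_def)
    have S: "?S x \<in> sets (PiM (?K x) (\<lambda>_. borel))" for x :: 'a
    proof -
      have [measurable]: "(\<lambda>v. v (x, i)) \<in> borel_measurable (PiM (?K x) (\<lambda>_. borel))" for i
        by (rule measurable_component_singleton) simp
      show ?thesis by measurable
    qed
    have pre: "(\<lambda>w. restrict (\<lambda>i. w i) (?K x)) -` ?S x \<inter> space waiting_law = ?E x" for x :: 'a
      by (auto simp: space_waiting space_PiM ring_time_def)
    have "prob (\<Inter>x\<in>C. ?E x) = (\<Prod>x\<in>C. prob (?E x))"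
      using indep_varsD_finite[OF ind False assms(3) S] unfolding pre .
    also have "\<dots> \<le> (\<Prod>x\<in>C. b - a)"
      using assms by (intro prod_mono conjI prob_ex_ring_in) auto
    finally show ?thesis unfolding eq by simp
  qed simp
qed

text \<open>An infinite backward chain of rings accumulates at a time, so it eventually stays in one
  short time slice and explores an infinite cluster of vertices that ring in this slice.\<close>

lemma no_backward_chain:
  fixes ring :: "'x \<Rightarrow> nat \<Rightarrow> real"
  assumes mono: "\<And>x. strict_mono (ring x)" and pos: "\<And>x. 0 < ring x 0"
    and unb: "\<And>x t. \<exists>n. t < ring x n" and \<delta>: "0 < \<delta>"
    and clusters: "\<And>u k. \<exists>N. \<forall>C. animal adj u C \<and> card C \<ge> N \<longrightarrow>
      \<not> (\<forall>x\<in>C. \<exists>n. ring x n \<in> {real k * \<delta>..<real (Suc k) * \<delta>})"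
  shows "\<nexists>x n. \<forall>i. adj (x i) (x (Suc i)) \<and> ring (x (Suc i)) (n (Suc i)) < ring (x i) (n i)"
proof
  assume "\<exists>x n. \<forall>i. adj (x i) (x (Suc i)) \<and> ring (x (Suc i)) (n (Suc i)) < ring (x i) (n i)"
  then obtain x n where adj: "\<And>i. adj (x i) (x (Suc i))"
    and dec: "\<And>i. ring (x (Suc i)) (n (Suc i)) < ring (x i) (n i)" by blast
  define t where "t i = ring (x i) (n i)" for i
  have t_dec: "i < j \<Longrightarrow> t j < t i" for i j
    by (rule lift_Suc_mono_less[of "\<lambda>i. - t i", simplified]) (simp_all add: t_def dec)
  have t_pos: "0 < t i" for i
    using pos[of "x i"] strict_mono_less_eq[OF mono, of "x i" 0 "n i"] by (simp add: t_def)
  define L where "L = Inf (range t)"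
  have bdd: "bdd_below (range t)" using t_pos by (intro bdd_belowI[of _ 0]) (auto intro: less_imp_le)
  have L_le: "L \<le> t i" for i unfolding L_def using bdd by (intro cInf_lower) auto
  have L_nn: "0 \<le> L" unfolding L_def using t_pos by (intro cInf_greatest) (auto intro: less_imp_le)
  \<comment> \<open>The slice that contains the limit \<open>L\<close> of the times. Being closed on
    the left and open on the right, it contains all late times of the chain, even when
    \<open>L\<close> is its left end.\<close>
  define k where "k = nat \<lfloor>L / \<delta>\<rfloor>"
  have "real k = of_int \<lfloor>L / \<delta>\<rfloor>" unfolding k_def using L_nn \<delta> by simp
  then have "real k \<le> L / \<delta>" "L / \<delta> < real k + 1" by linarith+
  then have k: "real k * \<delta> \<le> L" "L < real (Suc k) * \<delta>"
    using \<delta> by (simp_all add: field_simps)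
  obtain i0 where i0: "t i0 < real (Suc k) * \<delta>"
    using cInf_lessD[of "range t", folded L_def, OF _ k(2)] by auto
  let ?I = "{real k * \<delta>..<real (Suc k) * \<delta>}"
  have tI: "t (i0 + i) \<in> ?I" for i
    using k(1) L_le[of "i0 + i"] i0 t_dec[of i0 "i0 + i"] by (cases i) auto
  let ?Y = "{y. \<exists>m. ring y m \<in> ?I}"
  let ?R = "reach adj ?Y (x i0)"
  have xY: "x (i0 + i) \<in> ?Y" for i using tI[of i] by (auto simp: t_def)
  have xR: "x (i0 + i) \<in> ?R" for i
  proof (induction i)
    case (Suc i)
    then show ?case using reach_step[OF Suc, of "x (i0 + Suc i)"] adj[of "i0 + i"] xY[of "Suc i"] by simp
  qed (simp add: reach_root)
  \<comment> \<open>The pairs of vertex and ring are distinct along the chain, as the times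
    decrease. A finite cluster would hold only finitely many of them, since each vertex rings
    finitely often in the slice.\<close>
  have "infinite ?R"
  proof
    assume fin: "finite ?R"
    have "finite {m. ring y m \<in> ?I}" for y
    proof -
      obtain m0 where "real (Suc k) * \<delta> < ring y m0" using unb by blast
      then have "m \<le> m0" if "ring y m \<in> ?I" for m
        using that strict_mono_less_eq[OF mono, of y m0 m] by (cases "m \<le> m0") simp_all
      then have "{m. ring y m \<in> ?I} \<subseteq> {..m0}" by blast
      then show ?thesis using finite_subset by blast
    qed
    then have "finite (SIGMA y:?R. {m. ring y m \<in> ?I})" using fin by auto
    moreover have "range (\<lambda>i. (x (i0 + i), n (i0 + i))) \<subseteq> (SIGMA y:?R. {m. ring y m \<in> ?I})"
      using xR tI by (auto simp: t_def)
    moreover have "inj (\<lambda>i. (x (i0 + i), n (i0 + i)))"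
    proof (rule injI)
      fix i j assume "(x (i0 + i), n (i0 + i)) = (x (i0 + j), n (i0 + j))"
      then have "t (i0 + i) = t (i0 + j)" by (simp add: t_def)
      then show "i = j" using t_dec[of "i0 + i" "i0 + j"] t_dec[of "i0 + j" "i0 + i"]
        by (metis add_less_cancel_left less_irrefl linorder_neqE_nat)
    qed
    ultimately show False using finite_subset range_inj_infinite by blast
  qed
  obtain N where N: "\<forall>C. animal adj (x i0) C \<and> card C \<ge> N \<longrightarrow> \<not> (\<forall>x\<in>C. \<exists>n. ring x n \<in> ?I)"
    using clusters by blast
  obtain C where C: "animal adj (x i0) C" "C \<subseteq> ?R" "card C = Suc N"
    using animal_in_reach[of "Suc N" adj ?Y "x i0"] \<open>infinite ?R\<close> by auto
  have "?R \<subseteq> ?Y" using xY[of 0] by (intro reach_sub) simp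
  then have "\<forall>x\<in>C. \<exists>n. ring x n \<in> ?I" using C(2) by blast
  moreover have "N \<le> card C" using C(3) by simp
  ultimately show False using N C(1) by blast
qed

lemma AE_clocks:
  fixes adj :: "'x \<Rightarrow> 'x \<Rightarrow> bool"
  assumes "countable (UNIV :: 'x set)" "symp adj" "\<And>u. finite {v. adj u v}"
    "\<And>u. card {v. adj u v} \<le> D" "1 \<le> D"
  shows "AE w in waiting_law. clocks adj (ring_time w)"
proof -
  \<comment> \<open>This makes \<open>real D ^ 2 * \<delta>\<close> equal to one half, so the bounds
    over the sizes of animals are summable.\<close>
  define \<delta> where "\<delta> = 1 / (2 * real D ^ 2)"
  have \<delta>: "0 < \<delta>" "real D ^ 2 * \<delta> < 1" using assms(5) by (auto simp: \<delta>_def)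
  have slice: "0 \<le> real k * \<delta>" "real k * \<delta> \<le> real (Suc k) * \<delta>" "real (Suc k) * \<delta> - real k * \<delta> = \<delta>" for k
    using \<delta> by (auto simp: algebra_simps)
  have "AE w in waiting_law. \<exists>N. \<forall>C. animal adj u C \<and> card C \<ge> N \<longrightarrow>
      w \<notin> {w. \<forall>x\<in>C. \<exists>n. ring_time w x n \<in> {real k * \<delta>..<real (Suc k) * \<delta>}}" for u k
  proof (rule animal_borel_cantelli[OF prob_space_waiting assms(2-5)])
    show "0 \<le> \<delta>" "real D ^ 2 * \<delta> < 1" using \<delta> by auto
    fix C assume "animal adj u C"
    then have "finite C" by (rule animal_finite)
    note prob_all_ring_in[OF slice(1,2) this, of k, unfolded slice(3)]
    then show "{w. \<forall>x\<in>C. \<exists>n. ring_time w x n \<in> {real k * \<delta>..<real (Suc k) * \<delta>}} \<in> sets waiting_law"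
      "measure waiting_law {w. \<forall>x\<in>C. \<exists>n. ring_time w x n \<in> {real k * \<delta>..<real (Suc k) * \<delta>}} \<le> \<delta> ^ card C"
      by simp_all
  qed
  then have "AE w in waiting_law. \<forall>u\<in>UNIV. \<forall>k. \<exists>N. \<forall>C. animal adj u C \<and> card C \<ge> N \<longrightarrow>
      w \<notin> {w. \<forall>x\<in>C. \<exists>n. ring_time w x n \<in> {real k * \<delta>..<real (Suc k) * \<delta>}}"
    using assms(1) by (subst AE_ball_countable) (auto simp: AE_all_countable)
  moreover have "AE w in waiting_law. \<forall>x\<in>(UNIV :: 'x set). \<forall>t. \<exists>n. t < ring_time w x n"
    using assms(1) AE_ring_unbounded by (subst AE_ball_countable) auto
  moreover have "AE w in waiting_law. \<forall>i\<in>(UNIV :: ('x \<times> nat) set). 0 < w i"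
    using countable_SIGMA[OF assms(1), of "\<lambda>_. UNIV :: nat set"] AE_waiting_pos
    by (subst AE_ball_countable) (auto simp: UNIV_Times_UNIV)
  ultimately show ?thesis
  proof eventually_elim
    case (elim w)
    have mono: "strict_mono (ring_time w x)" for x
      using elim(3) by (intro strict_monoI_Suc) (simp add: ring_time_def)
    have pos: "0 < ring_time w x 0" for x using elim(3) by (simp add: ring_time_def)
    have "\<nexists>x n. \<forall>i. adj (x i) (x (Suc i)) \<and> ring_time w (x (Suc i)) (n (Suc i)) < ring_time w (x i) (n i)"
      by (rule no_backward_chain[OF mono pos _ \<delta>(1)]) (use elim(1,2) in \<open>simp_all\<close>)
    then show ?case
      using elim(2) assms(3) mono pos by (intro clocks.intro) auto
  qed
qed

section \<open>The initial configuration\<close>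

lemma prob_space_initial: "prob_space (initial_law \<theta>)"
  unfolding initial_law_def by (intro prob_space_PiM prob_space_measure_pmf)

lemma prob_all_Minus:
  assumes "0 \<le> \<theta>" "\<theta> \<le> 1" "finite A"
  shows "{\<eta>. \<forall>a\<in>A. \<eta> a = Minus} \<in> sets (initial_law \<theta>)"
    "measure (initial_law \<theta>) {\<eta>. \<forall>a\<in>A. \<eta> a = Minus} = (1 - \<theta>) ^ card A"
proof -
  interpret product_prob_space "\<lambda>_. measure_pmf (spin_law \<theta>)" UNIV
    by (intro product_prob_spaceI prob_space_measure_pmf)
  have eq: "{\<eta>. \<forall>a\<in>A. \<eta> a = Minus} = prod_emb UNIV (\<lambda>_. measure_pmf (spin_law \<theta>)) A (Pi\<^sub>E A (\<lambda>_. {Minus}))"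
    unfolding prod_emb_def vimage_def restrict_PiE_iff by auto
  show "{\<eta>. \<forall>a\<in>A. \<eta> a = Minus} \<in> sets (initial_law \<theta>)"
    unfolding eq initial_law_def using assms(3) by (intro sets_PiM_I) auto
  have "(\<lambda>b. if b then Plus else Minus) -` {Minus} = {False}" by auto
  then have "measure (measure_pmf (spin_law \<theta>)) {Minus} = 1 - \<theta>"
    unfolding spin_law_def measure_map_pmf using assms(1,2) by (simp add: measure_pmf_single)
  then show "measure (initial_law \<theta>) {\<eta>. \<forall>a\<in>A. \<eta> a = Minus} = (1 - \<theta>) ^ card A"
    unfolding eq initial_law_def using assms(3) by (subst measure_PiM_emb) auto
qed

text \<open>Layers are grouped in pairs: \<open>(u, j)\<close> stands for the block \<open>{(u, 2 * j), (u, 2 * j + 1)}\<close>.\<close>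

definition minus_blocks :: "('v \<times> int \<Rightarrow> spin) \<Rightarrow> ('v \<times> int) set" where
  "minus_blocks \<eta> = {(u, j). \<eta> (u, 2 * j) = Minus \<or> \<eta> (u, 2 * j + 1) = Minus}"

text \<open>If at least half of the blocks of \<open>C\<close> contain a Minus, then at least
  \<open>card C / 2\<close> of the \<open>2 * card C\<close> vertices are Minus. There are at most
  \<open>4 ^ card C\<close> choices of such a set of vertices, each of probability at most
  \<open>1 - \<theta>\<close> to the power \<open>card C / 2\<close>.\<close>

lemma AE_minus_blocks:
  fixes adj :: "'v \<times> int \<Rightarrow> 'v \<times> int \<Rightarrow> bool"
  assumes "symp adj" "\<And>u. finite {v. adj u v}" "\<And>u. card {v. adj u v} \<le> D" "1 \<le> D"
    and "0 \<le> \<theta>" "\<theta> \<le> 1" "64 * real D ^ 4 * (1 - \<theta>) < 1"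
  shows "AE \<eta> in initial_law \<theta>. \<exists>N. \<forall>C. animal adj u C \<and> card C \<ge> N \<longrightarrow>
    2 * card (C \<inter> minus_blocks \<eta>) < card C"
proof -
  interpret prob_space "initial_law \<theta> :: ('v \<times> int \<Rightarrow> spin) measure" by (rule prob_space_initial)
  \<comment> \<open>The square root absorbs the factor one half in the exponent, so that only
    natural powers occur.\<close>
  define s where "s = sqrt (1 - \<theta>)"
  have s: "0 \<le> s" "s \<le> 1" "s ^ 2 = 1 - \<theta>" using assms by (auto simp: s_def)
  let ?U = "\<lambda>C. (\<lambda>(u, j). (u, 2 * j)) ` C \<union> (\<lambda>(u, j). (u, 2 * j + 1)) ` C"
  let ?F = "\<lambda>C. {A. A \<subseteq> ?U C \<and> card C \<le> 2 * card A}"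
  define Ev where "Ev C = (\<Union>A\<in>?F C. {\<eta>. \<forall>a\<in>A. \<eta> a = Minus})" for C :: "('v \<times> int) set"
  have "AE \<eta> in initial_law \<theta>. \<exists>N. \<forall>C. animal adj u C \<and> card C \<ge> N \<longrightarrow> \<eta> \<notin> Ev C"
  proof (rule animal_borel_cantelli[OF prob_space_initial assms(1-4)])
    show "0 \<le> 4 * s" using s by simp
    have "(real D ^ 2 * (4 * s)) ^ 2 < 1 ^ 2"
    proof -
      have "(real D ^ 2 * (4 * s)) ^ 2 = 16 * real D ^ 4 * s ^ 2"
        by (simp add: power2_eq_square power4_eq_xxxx)
      also have "\<dots> \<le> 64 * real D ^ 4 * (1 - \<theta>)" unfolding s(3) using assms(6) by (intro mult_right_mono) auto
      finally show ?thesis using assms(7) by simp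
    qed
    then show "real D ^ 2 * (4 * s) < 1" by (rule power_less_imp_less_base) simp
    fix C assume "animal adj u C"
    then have fin: "finite C" by (rule animal_finite)
    have finP: "finite (Pow (?U C))" using fin by blast
    have subP: "?F C \<subseteq> Pow (?U C)" by blast
    have finF: "finite (?F C)" by (rule finite_subset[OF subP finP])
    have "card (?F C) \<le> card (Pow (?U C))" by (rule card_mono[OF finP subP])
    also have "\<dots> = 2 ^ card (?U C)" using fin by (intro card_Pow) blast
    also have "\<dots> \<le> 2 ^ (2 * card C)"
    proof (rule power_increasing)
      have "card (?U C) \<le> card ((\<lambda>(u, j). (u, 2 * j)) ` C) + card ((\<lambda>(u, j). (u, 2 * j + 1)) ` C)"
        by (rule card_Un_le)
      also have "\<dots> \<le> card C + card C" using fin by (intro add_mono card_image_le)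
      finally show "card (?U C) \<le> 2 * card C" by simp
    qed simp
    also have "\<dots> = 4 ^ card C" unfolding power_mult by simp
    finally have "card (?F C) \<le> 4 ^ card C" .
    then have cardF: "real (card (?F C)) \<le> real (4 ^ card C)" by (rule of_nat_mono)
    have finA: "finite A" if "A \<in> ?F C" for A
      using that fin by (intro finite_subset[of A "?U C"]) auto
    show "Ev C \<in> sets (initial_law \<theta>)"
      unfolding Ev_def by (intro sets.finite_UN prob_all_Minus(1)[OF assms(5,6)] finF finA)
    have "prob (Ev C) \<le> (\<Sum>A\<in>?F C. prob {\<eta>. \<forall>a\<in>A. \<eta> a = Minus})"
      unfolding Ev_def by (intro measure_UNION_le prob_all_Minus(1)[OF assms(5,6)] finF finA)
    also have "\<dots> \<le> (\<Sum>A\<in>?F C. s ^ card C)"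
    proof (rule sum_mono)
      fix A assume A: "A \<in> ?F C"
      have "prob {\<eta>. \<forall>a\<in>A. \<eta> a = Minus} = s ^ (2 * card A)"
        using prob_all_Minus(2)[OF assms(5,6) finA[OF A]] s(3) by (simp add: power_mult)
      also have "\<dots> \<le> s ^ card C" using A s by (intro power_decreasing) auto
      finally show "prob {\<eta>. \<forall>a\<in>A. \<eta> a = Minus} \<le> s ^ card C" .
    qed
    also have "\<dots> = real (card (?F C)) * s ^ card C" by simp
    also have "\<dots> \<le> real (4 ^ card C) * s ^ card C"
      using cardF by (rule mult_right_mono) (rule zero_le_power[OF s(1)])
    finally show "prob (Ev C) \<le> (4 * s) ^ card C" by (simp add: power_mult_distrib)
  qed
  then show ?thesis
  proof eventually_elim
    case (elim \<eta>)
    then obtain N where N: "\<And>C. animal adj u C \<Longrightarrow> card C \<ge> N \<Longrightarrow> \<eta> \<notin> Ev C" by blast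
    have "2 * card (C \<inter> minus_blocks \<eta>) < card C" if C: "animal adj u C" "card C \<ge> N" for C
    proof (rule ccontr)
      assume *: "\<not> ?thesis"
      \<comment> \<open>One Minus vertex is chosen from each block, the lower one if possible.
        Halving the layer recovers the block, so the choice is injective.\<close>
      let ?f = "\<lambda>(u, j). (u, if \<eta> (u, 2 * j) = Minus then 2 * j else 2 * j + 1)"
      let ?A = "?f ` (C \<inter> minus_blocks \<eta>)"
      have "card ?A = card (C \<inter> minus_blocks \<eta>)"
        by (intro card_image inj_on_inverseI[where g = "\<lambda>(u, i). (u, i div 2)"]) auto
      moreover have "?A \<subseteq> ?U C"
      proof (rule image_subsetI)
        fix p assume "p \<in> C \<inter> minus_blocks \<eta>"
        then have "(\<lambda>(u, j). (u, 2 * j)) p \<in> ?U C" "(\<lambda>(u, j). (u, 2 * j + 1)) p \<in> ?U C" by blast+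
        then show "?f p \<in> ?U C" by (cases p) (simp del: Un_iff)
      qed
      ultimately have "?A \<in> ?F C" using * by simp
      moreover have "\<forall>a\<in>?A. \<eta> a = Minus" by (auto simp: minus_blocks_def split: if_splits)
      ultimately have "\<eta> \<in> Ev C" unfolding Ev_def by blast
      then show False using N[OF C] by blast
    qed
    then show ?case by blast
  qed
qed

section \<open>Stacks of trees\<close>

lemma stack_nbrs:
  "{y. stack adj (u, i) y} = (\<lambda>v. (v, i)) ` {v. adj u v} \<union> {(u, i - 1), (u, i + 1)}"
  by (auto simp: stack_def)

lemma symp_stack: "symp adj \<Longrightarrow> symp (stack adj)"
  by (auto simp: symp_def stack_def)

lemma finite_stack_nbrs:
  assumes "\<And>u. finite {v. adj u v}"
  shows "finite {y. stack adj x y}"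
  using assms by (cases x) (simp add: stack_nbrs)

lemma card_stack_nbrs_in:
  assumes "irreflp adj" "finite {v. adj u v}"
  shows "card {y\<in>S. stack adj (u, i) y} =
    card {v. adj u v \<and> (v, i) \<in> S} + card (S \<inter> {(u, i - 1), (u, i + 1)})"
proof -
  have "{y\<in>S. stack adj (u, i) y} =
      (\<lambda>v. (v, i)) ` {v. adj u v \<and> (v, i) \<in> S} \<union> (S \<inter> {(u, i - 1), (u, i + 1)})"
    using stack_nbrs[of adj u i] by auto
  also have "card \<dots> = card ((\<lambda>v. (v, i)) ` {v. adj u v \<and> (v, i) \<in> S}) + card (S \<inter> {(u, i - 1), (u, i + 1)})"
    using assms(2) by (intro card_Un_disjoint) auto
  also have "card ((\<lambda>v. (v, i)) ` {v. adj u v \<and> (v, i) \<in> S}) = card {v. adj u v \<and> (v, i) \<in> S}"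
    by (intro card_image) (auto simp: inj_on_def)
  finally show ?thesis .
qed

lemma card_stack_nbrs:
  assumes "irreflp adj" "finite {v. adj u v}"
  shows "card {y. stack adj (u, i) y} = card {v. adj u v} + 2"
  using card_stack_nbrs_in[OF assms, of UNIV i] by simp

text \<open>Keeping only the horizontal edges turns a stack of trees into a forest, so the density
  bound for forests applies to infection along \<open>level adj\<close>.\<close>

definition level :: "('v \<Rightarrow> 'v \<Rightarrow> bool) \<Rightarrow> 'v \<times> int \<Rightarrow> 'v \<times> int \<Rightarrow> bool" where
  "level adj x y \<longleftrightarrow> snd x = snd y \<and> adj (fst x) (fst y)"

lemma level_path_snd: "successively (level adj) p \<Longrightarrow> x \<in> set p \<Longrightarrow> snd x = snd (hd p)"
proof (induction p)
  case (Cons y p)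
  then show ?case by (cases p) (auto simp: level_def)
qed simp

text \<open>A horizontal path stays on one layer, so the projection to the tree is injective on it
  and maps cycles to cycles.\<close>

lemma level_acyclic:
  assumes "\<nexists>p. graph_cycle adj p"
  shows "\<nexists>p. graph_cycle (level adj) p"
proof
  assume "\<exists>p. graph_cycle (level adj) p"
  then obtain p where p: "length p \<ge> 3" "distinct p" "successively (level adj) p"
    "level adj (last p) (hd p)" by (auto simp: graph_cycle_def)
  have "p \<noteq> []" using p(1) by auto
  have "inj_on fst (set p)"
  proof (rule inj_onI)
    fix x y assume "x \<in> set p" "y \<in> set p" "fst x = fst y"
    then show "x = y"
      using level_path_snd[OF p(3), of x] level_path_snd[OF p(3), of y] by (simp add: prod_eq_iff)
  qed
  then have "distinct (map fst p)" using p(2) by (simp add: distinct_map)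
  moreover have "successively adj (map fst p)" unfolding successively_map
    by (rule successively_mono[OF p(3)]) (simp add: level_def)
  moreover have "adj (last (map fst p)) (hd (map fst p))"
    using p(4) \<open>p \<noteq> []\<close> by (simp add: last_map hd_map level_def)
  ultimately have "graph_cycle adj (map fst p)" using p(1) by (simp add: graph_cycle_def)
  then show False using assms by blast
qed

lemma homogeneous_treeD:
  assumes "homogeneous_tree K adj"
  shows "symp adj" "irreflp adj" "\<nexists>p. graph_cycle adj p" "connected_graph adj"
    "\<And>u. finite {v. adj u v}" "\<And>u. card {v. adj u v} = K"
  using assms by (simp_all add: homogeneous_tree_def tree_graph_def simple_graph_def)

text \<open>An uninfected vertex has at most one infected neighbour in its tree, so it sees at least
  \<open>K - 1\<close> uninfected blocks on its level besides the other vertex of its own block.\<close>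

lemma uninfected_fixated:
  assumes tree: "homogeneous_tree K adj" and K: "K \<ge> 3"
    and clk: "clocks (stack adj) ring" and u: "\<not> infected (level adj) (minus_blocks init) (u, i div 2)"
  shows "(u, i) \<in> clocks.fixated (stack adj) ring init coin"
proof -
  interpret clocks "stack adj" ring by fact
  note [simp] = homogeneous_treeD(6)[OF tree]
  note fin = homogeneous_treeD(5)[OF tree] and irr = homogeneous_treeD(2)[OF tree]
  let ?I = "infected (level adj) (minus_blocks init)"
  define S where "S = {(u, i). \<not> ?I (u, i div 2)}"
  have "trajectory init coin (u, i) t = Plus" for t
  proof (rule trajectory_stable)
    show "(u, i) \<in> S" using u by (simp add: S_def)
    fix x assume x: "x \<in> S"
    obtain v j where vj: "x = (v, j)" by fastforce
    have vI: "\<not> ?I (v, j div 2)" using x by (simp add: S_def vj)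
    have "(v, j div 2) \<notin> minus_blocks init" using vI by (blast intro: infected.init)
    then have "init (v, 2 * (j div 2)) = Plus" "init (v, 2 * (j div 2) + 1) = Plus"
      using spin.exhaust by (auto simp: minus_blocks_def)
    moreover have "j = 2 * (j div 2) \<or> j = 2 * (j div 2) + 1" by presburger
    ultimately show "init x = Plus" unfolding vj by metis
    let ?N = "{w. adj v w}" and ?J = "{w. adj v w \<and> ?I (w, j div 2)}"
    have "card ?J \<le> 1"
    proof (rule ccontr)
      assume "\<not> card ?J \<le> 1"
      moreover have "finite ?J" using fin[of v] by (rule finite_subset[rotated]) blast
      ultimately obtain w1 w2 where "w1 \<in> ?J" "w2 \<in> ?J" "w1 \<noteq> w2"
        using card_le_Suc0_iff_eq[of ?J] unfolding One_nat_def by blast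
      then have "?I (v, j div 2)"
        using infected.spread[of "level adj" "(v, j div 2)" "(w1, j div 2)" "(w2, j div 2)"]
        by (simp add: level_def)
      then show False using vI by simp
    qed
    moreover have "{w. adj v w \<and> (w, j) \<in> S} = ?N - ?J" by (auto simp: S_def)
    moreover have "card (?N - ?J) = card ?N - card ?J"
      using fin[of v] by (intro card_Diff_subset) (auto intro: finite_subset)
    ultimately have 1: "card {w. adj v w \<and> (w, j) \<in> S} \<ge> K - 1" by simp
    \<comment> \<open>This is the other vertex of the block: an even layer is paired with the one
      above it, an odd layer with the one below.\<close>
    have "(v, if even j then j + 1 else j - 1) \<in> S \<inter> {(v, j - 1), (v, j + 1)}"
    proof -
      have "(if even j then j + 1 else j - 1) div 2 = j div 2" by (simp, presburger)
      then show ?thesis using vI by (simp add: S_def)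
    qed
    then have "card (S \<inter> {(v, j - 1), (v, j + 1)}) \<ge> 1"
      by (metis One_nat_def Suc_leI card_gt_0_iff empty_iff finite.emptyI finite_Int finite_insert)
    then have "card {y\<in>S. stack adj x y} \<ge> K"
      using 1 K unfolding vj card_stack_nbrs_in[OF irr fin] by simp
    moreover have "card {y. stack adj x y} = K + 2"
      unfolding vj card_stack_nbrs[OF irr fin] by simp
    \<comment> \<open>The hypothesis \<open>K \<ge> 3\<close> gives
      \<open>K + 2 < 2 * K\<close>.\<close>
    ultimately show "card {y. stack adj x y} < 2 * card {y\<in>S. stack adj x y}" using K by simp
  qed
  then show ?thesis by (auto simp: fixated_def)
qed

text \<open>A finite component of vertices that do not fixate would have a vertex that is a leaf of its
  top level. It has at most two neighbours in the component, hence the majority of its neighbours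
  fixates.\<close>

lemma infinite_unfixated:
  assumes tree: "homogeneous_tree K adj" and K: "K \<ge> 3"
    and clk: "clocks (stack adj) ring" and x: "x \<notin> clocks.fixated (stack adj) ring init coin"
  shows "infinite (reach (stack adj) (- clocks.fixated (stack adj) ring init coin) x)"
proof
  interpret clocks "stack adj" ring by fact
  note [simp] = homogeneous_treeD(6)[OF tree]
  note fin = homogeneous_treeD(5)[OF tree] and irr = homogeneous_treeD(2)[OF tree]
  let ?F = "fixated init coin"
  let ?R = "reach (stack adj) (- ?F) x"
  assume finR: "finite ?R"
  have sub: "?R \<subseteq> - ?F" using x by (intro reach_sub) simp
  define l where "l = Max (snd ` ?R)"
  have "l \<in> snd ` ?R" unfolding l_def
    using finR reach_root[of x "stack adj" "- ?F"] by (intro Max_in) auto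
  then have ne: "{u. (u, l) \<in> ?R} \<noteq> {}" by auto
  have "finite {u. (u, l) \<in> ?R}"
    using finite_imageI[OF finR, of fst] by (rule finite_subset[rotated]) force
  from forest_leaf[OF homogeneous_treeD(1-3)[OF tree] this ne]
  obtain u where u: "(u, l) \<in> ?R" "card {v \<in> {u. (u, l) \<in> ?R}. adj u v} \<le> 1" by blast
  have top: "(u, l + 1) \<notin> ?R"
  proof
    assume "(u, l + 1) \<in> ?R"
    then have "l + 1 \<le> l" unfolding l_def using finR by (intro Max_ge) force+
    then show False by simp
  qed
  \<comment> \<open>A neighbour of a cluster vertex that is not fixated belongs to the
    cluster.\<close>
  have "{y\<in>?R. stack adj (u, l) y} \<union> {y\<in>?F. stack adj (u, l) y} = {y. stack adj (u, l) y}"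
    using reach_step[OF u(1)] by auto
  moreover have "card ({y\<in>?R. stack adj (u, l) y} \<union> {y\<in>?F. stack adj (u, l) y})
      \<le> card {y\<in>?R. stack adj (u, l) y} + card {y\<in>?F. stack adj (u, l) y}"
    by (rule card_Un_le)
  ultimately have "K + 2 \<le> card {y\<in>?R. stack adj (u, l) y} + card {y\<in>?F. stack adj (u, l) y}"
    using card_stack_nbrs[OF irr fin, of u l] by simp
  \<comment> \<open>These are at most one neighbour on the level, by the choice of a leaf, and
    possibly the one below; the one above is beyond the top.\<close>
  moreover have "card {y\<in>?R. stack adj (u, l) y} \<le> 2"
  proof -
    have "card (?R \<inter> {(u, l - 1), (u, l + 1)}) \<le> card {(u, l - 1)}"
      using top by (intro card_mono) auto
    moreover have "{v. adj u v \<and> (v, l) \<in> ?R} = {v \<in> {u. (u, l) \<in> ?R}. adj u v}" by auto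
    ultimately show ?thesis using u(2) unfolding card_stack_nbrs_in[OF irr fin] by simp
  qed
  ultimately have "card {y. stack adj (u, l) y} < 2 * card {y\<in>?F. stack adj (u, l) y}"
    using K card_stack_nbrs[OF irr fin, of u l] by simp
  then have "(u, l) \<in> ?F" by (rule fixated_majority)
  then show False using u(1) sub by auto
qed

section \<open>Passage from vertices to blocks\<close>

text \<open>Adjacent vertices lie in the same block or in adjacent blocks, so a path of vertices
  projects to a path of blocks.\<close>

lemma reach_blocks:
  assumes "y \<in> reach (stack adj) Y x"
  shows "(fst y, snd y div 2) \<in> reach (stack adj) ((\<lambda>(u, i). (u, i div 2)) ` Y) (fst x, snd x div 2)"
proof -
  have "(\<lambda>a b. stack adj a b \<and> b \<in> Y)\<^sup>*\<^sup>* x y" using assms by (simp add: reach_def)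
  then show ?thesis
  proof (induction rule: rtranclp_induct)
    case (step y z)
    let ?b = "\<lambda>y. (fst y, snd y div 2)"
    have "?b z \<in> (\<lambda>(u, i). (u, i div 2)) ` Y" using step.hyps by (force simp: case_prod_beta)
    moreover have "?b y = ?b z \<or> stack adj (?b y) (?b z)"
    proof -
      have div: "\<bar>i - j\<bar> = 1 \<Longrightarrow> i div 2 = j div 2 \<or> \<bar>i div 2 - j div 2\<bar> = 1" for i j :: int
        by presburger
      have "stack adj y z" using step.hyps(2) by simp
      then show ?thesis unfolding stack_def fst_conv snd_conv using div[of "snd y" "snd z"] by metis
    qed
    ultimately show ?case using step.IH reach_step by (metis (no_types, lifting))
  qed (simp add: reach_root)
qed

text \<open>A vertex that does not fixate has an infinite cluster; as a block has only two vertices,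
  the blocks form an infinite cluster too, and all of them are infected. Then there are arbitrarily
  large animals with at least half of their blocks in \<open>minus_blocks init\<close>, against
  \<open>sparse\<close>.\<close>

lemma all_fixated:
  assumes tree: "homogeneous_tree K adj" and K: "K \<ge> 3" and clk: "clocks (stack adj) ring"
    and sparse: "\<And>p. \<exists>N. \<forall>C. animal (stack adj) p C \<and> card C \<ge> N \<longrightarrow>
      2 * card (C \<inter> minus_blocks init) < card C"
  shows "x \<in> clocks.fixated (stack adj) ring init coin"
proof (rule ccontr)
  let ?F = "clocks.fixated (stack adj) ring init coin"
  let ?b = "\<lambda>(u, i). (u, i div 2)"
  assume x: "x \<notin> ?F"
  let ?R = "reach (stack adj) (- ?F) x" and ?p = "(fst x, snd x div 2)"
  let ?Q = "reach (stack adj) (?b ` (- ?F)) ?p"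
  have inf: "infinite ?R" by (rule infinite_unfixated[OF tree K clk x])
  have "?R \<subseteq> (\<lambda>(u, j). (u, 2 * j)) ` ?Q \<union> (\<lambda>(u, j). (u, 2 * j + 1)) ` ?Q"
  proof
    fix y assume "y \<in> ?R"
    then have y: "(fst y, snd y div 2) \<in> ?Q" by (rule reach_blocks)
    have "y = (fst y, 2 * (snd y div 2)) \<or> y = (fst y, 2 * (snd y div 2) + 1)"
      by (cases y) (simp, presburger)
    then show "y \<in> (\<lambda>(u, j). (u, 2 * j)) ` ?Q \<union> (\<lambda>(u, j). (u, 2 * j + 1)) ` ?Q"
      using y by force
  qed
  then have infQ: "infinite ?Q" using inf finite_subset by blast
  have "?p \<in> ?b ` (- ?F)" using x by (force simp: case_prod_beta)
  then have subQ: "?Q \<subseteq> ?b ` (- ?F)" by (rule reach_sub)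
  have infected: "infected (level adj) (minus_blocks init) q" if "q \<in> ?Q" for q
  proof -
    obtain u i where "q = (u, i div 2)" "(u, i) \<notin> ?F" using subQ \<open>q \<in> ?Q\<close> by auto
    then show ?thesis using uninfected_fixated[OF tree K clk] by metis
  qed
  obtain N where N: "\<And>C. animal (stack adj) ?p C \<Longrightarrow> card C \<ge> N \<Longrightarrow>
      2 * card (C \<inter> minus_blocks init) < card C" using sparse by blast
  have lev: "symp (level adj)" "irreflp (level adj)"
    using homogeneous_treeD(1,2)[OF tree] by (auto simp: level_def symp_def irreflp_def)
  \<comment> \<open>The size \<open>Suc N\<close> is taken because \<open>infected_animal\<close>
    requires a positive one.\<close>
  have "\<exists>C. animal (stack adj) ?p C \<and> card C \<ge> Suc N \<and> card C \<le> 2 * card (C \<inter> minus_blocks init)"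
    by (rule infected_animal[OF lev level_acyclic[OF homogeneous_treeD(3)[OF tree]] _ infQ infected])
       (auto simp: level_def stack_def)
  then show False using N by (meson Suc_leD not_le)
qed

section \<open>Almost sure events in product spaces\<close>

lemma AE_fst:
  assumes "prob_space M" "AE x in N. P x"
  shows "AE z in N \<Otimes>\<^sub>M M. P (fst z)"
proof -
  interpret prob_space M by fact
  have "AE x in distr (N \<Otimes>\<^sub>M M) N fst. P x" using assms(2) unfolding distr_pair_fst .
  then show ?thesis by (rule AE_distrD[rotated]) simp
qed

lemma AE_snd:
  assumes "prob_space M" "AE x in M. P x"
  shows "AE z in N \<Otimes>\<^sub>M M. P (snd z)"
proof -
  interpret prob_space M by fact
  obtain A where A: "{x\<in>space M. \<not> P x} \<subseteq> A" "A \<in> null_sets M"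
    using assms(2) by (auto simp: eventually_ae_filter)
  then have "space N \<times> A \<in> null_sets (N \<Otimes>\<^sub>M M)"
    by (auto simp: null_sets_def emeasure_pair_measure_Times)
  then show ?thesis
    by (rule AE_I') (use A(1) in \<open>auto simp: space_pair_measure\<close>)
qed

theorem theorem2p1:
  fixes K :: nat
  assumes "K \<ge> 3"
  shows "\<exists>\<theta>0<1. \<forall>\<theta>. \<theta>0 < \<theta> \<and> 0 \<le> \<theta> \<and> \<theta> \<le> 1 \<longrightarrow>
    (\<forall>adj :: 'v \<Rightarrow> 'v \<Rightarrow> bool. homogeneous_tree K adj \<longrightarrow> fixates_to_plus (stack adj) \<theta>)"
proof (intro exI[of _ "1 - 1 / (64 * real (K + 2) ^ 4)"] conjI allI impI)
  \<comment> \<open>The threshold solves \<open>64 * real D ^ 4 * (1 - \<theta>) < 1\<close> for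
    \<open>\<theta>\<close>, with \<open>D = K + 2\<close> the degree of the stack.\<close>
  show "1 - 1 / (64 * real (K + 2) ^ 4) < 1" by simp
  fix \<theta> :: real and adj :: "'v \<Rightarrow> 'v \<Rightarrow> bool"
  assume \<theta>: "1 - 1 / (64 * real (K + 2) ^ 4) < \<theta> \<and> 0 \<le> \<theta> \<and> \<theta> \<le> 1"
    and tree: "homogeneous_tree K adj"
  have "1 - \<theta> < 1 / (64 * real (K + 2) ^ 4)" using \<theta> by linarith
  then have small: "64 * real (K + 2) ^ 4 * (1 - \<theta>) < 1" by (simp add: pos_less_divide_eq mult.commute)
  note T = homogeneous_treeD[OF tree]
  have sym: "symp (stack adj)" using T(1) by (rule symp_stack)
  have fin: "finite {y. stack adj x y}" for x using T(5) by (rule finite_stack_nbrs)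
  have deg: "card {y. stack adj x y} \<le> K + 2" for x
    using card_stack_nbrs[OF T(2,5)] T(6) by (cases x) simp
  have "countable (UNIV :: 'v set)" using T(4,5) by (rule countable_connected)
  then have cnt: "countable (UNIV :: ('v \<times> int) set)"
    using countable_SIGMA[of "UNIV :: 'v set" "\<lambda>_. UNIV :: int set"] by simp
  have init: "AE \<eta> in initial_law \<theta>. \<forall>p\<in>(UNIV :: ('v \<times> int) set). \<exists>N. \<forall>C.
      animal (stack adj) p C \<and> card C \<ge> N \<longrightarrow> 2 * card (C \<inter> minus_blocks \<eta>) < card C"
    using AE_minus_blocks[OF sym fin deg _ _ _ small] \<theta>
    by (subst AE_ball_countable[OF cnt]) simp
  have dyn: "prob_space (dyn_law :: ((('v \<times> int) \<times> nat \<Rightarrow> real) \<times> (('v \<times> int) \<times> nat \<Rightarrow> spin)) measure)"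
    unfolding dyn_law_def coin_law_def
    by (intro prob_space_pair prob_space_waiting prob_space_PiM prob_space_measure_pmf)
  have sparse: "AE \<omega> in joint_law \<theta>. \<forall>p. \<exists>N. \<forall>C.
      animal (stack adj) p C \<and> card C \<ge> N \<longrightarrow> 2 * card (C \<inter> minus_blocks (fst \<omega>)) < card C"
    unfolding joint_law_def using AE_fst[OF dyn init] by simp
  have "AE w in waiting_law. clocks (stack adj) (ring_time w)"
    by (rule AE_clocks[OF cnt sym fin deg]) simp
  then have "AE d in dyn_law. clocks (stack adj) (ring_time (fst d))"
    unfolding dyn_law_def coin_law_def
    by (intro AE_fst prob_space_PiM prob_space_measure_pmf)
  then have clk: "AE \<omega> in joint_law \<theta>. clocks (stack adj) (ring_time (fst (snd \<omega>)))"
    unfolding joint_law_def by (rule AE_snd[OF dyn])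
  show "fixates_to_plus (stack adj) \<theta>"
    unfolding fixates_to_plus_def
  proof (intro allI)
    fix x
    \<comment> \<open>Where the Minus blocks are sparse and the clocks regular, the rest of the
      argument is deterministic.\<close>
    show "AE \<omega> in joint_law \<theta>. \<exists>T. \<forall>t\<ge>T. majority_process (stack adj) \<omega> x t = Plus"
      using sparse clk
    proof eventually_elim
      case (elim \<omega>)
      obtain \<eta> w c where \<omega>: "\<omega> = (\<eta>, w, c)" by (cases \<omega>) auto
      interpret clocks "stack adj" "ring_time w" using elim(2) \<omega> by simp
      have "x \<in> fixated \<eta> (\<lambda>x n. c (x, n))"
        by (rule all_fixated[OF tree assms clocks_axioms]) (use elim(1) \<omega> in \<open>simp only: fst_conv\<close>)
      then show ?case by (simp add: fixated_def majority_process_def \<omega> the_trajectory)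
    qed
  qed
qed

end
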